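(* Let $L_1,L_2>0$ with $L_1+L_2=2\pi$ and let $\Gamma_0$ be the basic cell of the necklace graph. Let $p>1$ and $\sigma>0$. Define $$\mathcal H=\left\{\varphi\in H^1(\mathbb{R}\times\Gamma_0)\cap C^0(\mathbb{R}\times\bar\Gamma_0):\ \varphi_0(\xi,L_1)=\varphi_\pm(\xi,L_1),\ \varphi_0(\xi,0)=\varphi_\pm(\xi,2\pi)\ \text{for all }\xi\in\mathbb{R}\right\}.$$ Then the infimum of the constrained variational problem $$\inf_{\varphi\in\mathcal H}\left\{\int_{\mathbb{R}\times\Gamma_0}\left(|(\partial_\xi+\partial_x)\varphi|^2+\sigma|\varphi|^2\right)d\xi\,dx:\ \int_{\mathbb{R}\times\Gamma_0}|\varphi|^{p+1}\,d\xi\,dx=1\right\}$$ is $0$ and it is not achieved.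
   Context: The basic cell $\Gamma_0$ of the necklace graph consists of three edges: one identified with $[0,L_1]$ and two identified with $[L_1,2\pi]$. A (complex-valued) function $\varphi(\xi,x)$ on $\mathbb{R}\times\Gamma_0$ is a triple $(\varphi_0,\varphi_+,\varphi_-)$ with $\varphi_0$ defined on $\mathbb{R}\times[0,L_1]$ and $\varphi_\pm$ on $\mathbb{R}\times[L_1,2\pi]$; $H^1(\mathbb{R}\times\Gamma_0)$ and $C^0(\mathbb{R}\times\bar\Gamma_0)$ mean that each component is in $H^1$ (resp. continuous up to the boundary) on its strip, and integrals over $\mathbb{R}\times\Gamma_0$ are sums over the three strips. *)

theory Defs
  imports "HOL-Analysis.Analysis"
begin

text \<open>
  The class of \<open>C\<^sup>\<infinity>\<close> functions: the greatest class of everywhere differentiable functions that is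
  closed under taking directional derivatives.
\<close>

coinductive smooth :: "('a::euclidean_space \<Rightarrow> real) \<Rightarrow> bool" where
  "(\<And>z. f differentiable (at z)) \<Longrightarrow> (\<And>v. smooth (\<lambda>z. frechet_derivative f (at z) v)) \<Longrightarrow> smooth f"

definition test_function :: "'a::euclidean_space set \<Rightarrow> ('a \<Rightarrow> real) \<Rightarrow> bool" where
  "test_function \<Omega> \<psi> \<longleftrightarrow>
     smooth \<psi> \<and> compact (closure {z. \<psi> z \<noteq> 0}) \<and> closure {z. \<psi> z \<noteq> 0} \<subseteq> \<Omega>"

definition square_integrable_on :: "('a::euclidean_space \<Rightarrow> complex) \<Rightarrow> 'a set \<Rightarrow> bool" where
  "square_integrable_on u \<Omega> \<longleftrightarrow>
     u \<in> borel_measurable (lebesgue_on \<Omega>) \<and> integrable (lebesgue_on \<Omega>) (\<lambda>z. (norm (u z))\<^sup>2)"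

text \<open>
  \<open>g\<close> is a square-integrable weak derivative of \<open>u\<close> in direction \<open>v\<close> on the open set \<open>\<Omega>\<close>.
  Real-valued test functions suffice for complex-valued \<open>u\<close>, by linearity.
\<close>

definition has_weak_deriv ::
    "('a::euclidean_space \<Rightarrow> complex) \<Rightarrow> ('a \<Rightarrow> complex) \<Rightarrow> 'a \<Rightarrow> 'a set \<Rightarrow> bool" where
  "has_weak_deriv u g v \<Omega> \<longleftrightarrow>
     square_integrable_on g \<Omega> \<and>
     (\<forall>\<psi>. test_function \<Omega> \<psi> \<longrightarrow>
        (LINT z|lebesgue_on \<Omega>. frechet_derivative \<psi> (at z) v *\<^sub>R u z)
          = - (LINT z|lebesgue_on \<Omega>. \<psi> z *\<^sub>R g z))"

text \<open>
  A representative of the weak derivative, which is unique up to null sets;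
  unspecified if there is none.
\<close>

definition weak_deriv ::
    "'a::euclidean_space set \<Rightarrow> 'a \<Rightarrow> ('a \<Rightarrow> complex) \<Rightarrow> 'a \<Rightarrow> complex" where
  "weak_deriv \<Omega> v u = (SOME g. has_weak_deriv u g v \<Omega>)"

definition H1 :: "'a::euclidean_space set \<Rightarrow> ('a \<Rightarrow> complex) set" where
  "H1 \<Omega> = {u. square_integrable_on u \<Omega> \<and> (\<forall>v\<in>Basis. \<exists>g. has_weak_deriv u g v \<Omega>)}"

text \<open>
  The necklace cell has one edge \<open>[0, L1]\<close> and two edges \<open>[L1, 2\<pi>]\<close>. Points of \<open>\<real> \<times> \<Gamma>\<^sub>0\<close> are pairs
  \<open>(\<xi>, x)\<close> on a given edge. Components of \<open>\<phi>\<close> are total functions; their values outside the closed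
  strip of the edge are irrelevant.
\<close>

datatype edge = E0 | Eplus | Eminus

fun edge_left :: "real \<Rightarrow> edge \<Rightarrow> real" where
  "edge_left L1 E0 = 0"
| "edge_left L1 Eplus = L1"
| "edge_left L1 Eminus = L1"

fun edge_right :: "real \<Rightarrow> edge \<Rightarrow> real" where
  "edge_right L1 E0 = L1"
| "edge_right L1 Eplus = 2 * pi"
| "edge_right L1 Eminus = 2 * pi"

definition open_strip :: "real \<Rightarrow> edge \<Rightarrow> (real \<times> real) set" where
  "open_strip L1 e = UNIV \<times> {edge_left L1 e <..< edge_right L1 e}"

definition closed_strip :: "real \<Rightarrow> edge \<Rightarrow> (real \<times> real) set" where
  "closed_strip L1 e = UNIV \<times> {edge_left L1 e .. edge_right L1 e}"

type_synonym cell_fun = "edge \<Rightarrow> real \<times> real \<Rightarrow> complex"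

definition cell_integral :: "real \<Rightarrow> (edge \<Rightarrow> real \<times> real \<Rightarrow> real) \<Rightarrow> real" where
  "cell_integral L1 F = (\<Sum>e\<in>{E0, Eplus, Eminus}. LINT z|lebesgue_on (open_strip L1 e). F e z)"

definition cell_space :: "real \<Rightarrow> cell_fun set" where
  "cell_space L1 = {\<phi>.
     (\<forall>e. \<phi> e \<in> H1 (open_strip L1 e) \<and> continuous_on (closed_strip L1 e) (\<phi> e)) \<and>
     (\<forall>\<xi>. \<forall>e\<in>{Eplus, Eminus}. \<phi> E0 (\<xi>, L1) = \<phi> e (\<xi>, L1) \<and> \<phi> E0 (\<xi>, 0) = \<phi> e (\<xi>, 2 * pi))}"

definition cell_energy :: "real \<Rightarrow> real \<Rightarrow> cell_fun \<Rightarrow> real" where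
  "cell_energy L1 \<sigma> \<phi> = cell_integral L1 (\<lambda>e z.
     (norm (weak_deriv (open_strip L1 e) (1, 0) (\<phi> e) z
            + weak_deriv (open_strip L1 e) (0, 1) (\<phi> e) z))\<^sup>2
     + \<sigma> * (norm (\<phi> e z))\<^sup>2)"

text \<open>
  The Bochner integral of a non-integrable function is \<open>0\<close>, so integrability on each strip is part
  of the constraint.
\<close>

definition admissible :: "real \<Rightarrow> real \<Rightarrow> cell_fun set" where
  "admissible L1 p = {\<phi> \<in> cell_space L1.
     (\<forall>e. integrable (lebesgue_on (open_strip L1 e)) (\<lambda>z. norm (\<phi> e z) powr (p + 1))) \<and>
     cell_integral L1 (\<lambda>e z. norm (\<phi> e z) powr (p + 1)) = 1}"

end

theory Submission
  imports Defs
begin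

text \<open>
  The operator \<open>\<partial>\<^sub>\<xi> + \<partial>\<^sub>x\<close> does not see concentration across its characteristics. Take \<open>\<phi> = c g(x) h(n (\<xi> - x))\<close>
  on the edge \<open>[0, L1]\<close> with bumps \<open>g\<close>, \<open>h\<close>, and \<open>\<phi> = 0\<close> on the other two edges. Then
  \<open>(\<partial>\<^sub>\<xi> + \<partial>\<^sub>x) \<phi> = c g'(x) h(n (\<xi> - x))\<close>, hence the energy is a constant times \<open>c\<^sup>2 / n\<close>, whereas the constraint
  makes \<open>c\<close> a constant times \<open>n\<close> to the power \<open>1 / (p + 1)\<close>. Since \<open>p > 1\<close>, the energy tends to \<open>0\<close>. The
  value \<open>0\<close> would force \<open>\<phi> = 0\<close> almost everywhere, against the constraint.

  As the energy is defined through chosen weak derivatives, evaluating it needs uniqueness of weak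
  derivatives, for which smooth bumps approximating indicators of boxes suffice.
\<close>

section \<open>Smooth functions\<close>

lemma smooth_differentiable: "smooth f \<Longrightarrow> f differentiable (at z)"
  by (erule smooth.cases) auto

lemma smooth_frechet_derivative: "smooth f \<Longrightarrow> smooth (\<lambda>z. frechet_derivative f (at z) v)"
  by (erule smooth.cases) auto

lemma smooth_has_derivative: "smooth f \<Longrightarrow> (f has_derivative frechet_derivative f (at z)) (at z)"
  using smooth_differentiable frechet_derivative_works by blast

lemma smooth_continuous_on: "smooth f \<Longrightarrow> continuous_on S f"
  by (intro continuous_at_imp_continuous_on ballI differentiable_imp_continuous_within smooth_differentiable)

text \<open>A linear map of the real line is multiplication by its value at 1, which turns the
  Frechet derivative into an ordinary one.\<close>

lemma smooth_real_has_derivative: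
  fixes f :: "real \<Rightarrow> real"
  assumes "smooth f"
  shows "(f has_real_derivative frechet_derivative f (at t) 1) (at t)"
proof -
  interpret linear "frechet_derivative f (at t)"
    using assms by (simp add: linear_frechet_derivative smooth_differentiable)
  have "frechet_derivative f (at t) v = frechet_derivative f (at t) 1 * v" for v
    using scaleR[of v 1] by (simp add: mult.commute)
  then have "frechet_derivative f (at t) = (*) (frechet_derivative f (at t) 1)"
    by (rule ext)
  with smooth_has_derivative[OF assms, of t] show ?thesis
    by (simp add: has_field_derivative_def)
qed

text \<open>A form of coinduction in which the derivative is given explicitly. Uniqueness of
  derivatives identifies \<open>f'\<close> with \<open>frechet_derivative\<close>, so later
  smoothness proofs only have to exhibit a class of functions closed under differentiation.\<close>

lemma smoothI:
  assumes "P f"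
    and "\<And>f. P f \<Longrightarrow> \<exists>f'. (\<forall>z. (f has_derivative f' z) (at z)) \<and> (\<forall>v. P (\<lambda>z. f' z v))"
  shows "smooth f"
  using assms(1)
proof (coinduction arbitrary: f rule: smooth.coinduct)
  case (smooth f)
  then obtain f' where f': "\<And>z. (f has_derivative f' z) (at z)" "\<And>v. P (\<lambda>z. f' z v)"
    using assms(2) by blast
  have "f differentiable at z" for z
    using f'(1) by (auto simp: differentiable_def)
  moreover have "P (\<lambda>z. frechet_derivative f (at z) v)" for v
    using f'(2)[of v] by (simp add: frechet_derivative_at[OF f'(1), symmetric])
  ultimately show ?case by blast
qed

text \<open>
  The product rule leaves the class of products, so coinduction needs an invariant that is closed under
  sums and products.
\<close>

inductive smooth_alg :: "('a::euclidean_space \<Rightarrow> real) \<Rightarrow> bool" where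
  base: "smooth f \<Longrightarrow> smooth_alg f"
| add: "smooth_alg f \<Longrightarrow> smooth_alg g \<Longrightarrow> smooth_alg (\<lambda>z. f z + g z)"
| mult: "smooth_alg f \<Longrightarrow> smooth_alg g \<Longrightarrow> smooth_alg (\<lambda>z. f z * g z)"

lemma smooth_alg_derivative:
  assumes "smooth_alg f"
  shows "\<exists>f'. (\<forall>z. (f has_derivative f' z) (at z)) \<and> (\<forall>v. smooth_alg (\<lambda>z. f' z v))"
  using assms
proof induction
  case (base f)
  then show ?case
    by (intro exI[of _ "\<lambda>z. frechet_derivative f (at z)"])
      (auto intro: smooth_has_derivative smooth_alg.base smooth_frechet_derivative)
next
  case (add f g)
  then obtain f' g' where "\<forall>z. (f has_derivative f' z) (at z)" "\<forall>v. smooth_alg (\<lambda>z. f' z v)"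
    "\<forall>z. (g has_derivative g' z) (at z)" "\<forall>v. smooth_alg (\<lambda>z. g' z v)" by blast
  then show ?case
    by (intro exI[of _ "\<lambda>z v. f' z v + g' z v"] conjI allI has_derivative_add smooth_alg.add) blast+
next
  case (mult f g)
  then obtain f' g' where "\<forall>z. (f has_derivative f' z) (at z)" "\<forall>v. smooth_alg (\<lambda>z. f' z v)"
    "\<forall>z. (g has_derivative g' z) (at z)" "\<forall>v. smooth_alg (\<lambda>z. g' z v)" by blast
  with mult.hyps show ?case
    by (intro exI[of _ "\<lambda>z v. f z * g' z v + f' z v * g z"] conjI allI has_derivative_mult
        smooth_alg.add smooth_alg.mult) blast+
qed

lemma smooth_algD: "smooth_alg f \<Longrightarrow> smooth f"
  using smoothI[of smooth_alg] smooth_alg_derivative by blast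

lemma smooth_mult: "smooth f \<Longrightarrow> smooth g \<Longrightarrow> smooth (\<lambda>z. f z * g z)"
  by (rule smooth_algD, rule smooth_alg.mult; rule smooth_alg.base)

lemma smooth_const: "smooth (\<lambda>z. c)"
  by (rule smoothI[where P = "\<lambda>f. \<exists>c. f = (\<lambda>z. c)"]) (auto intro!: exI[of _ "\<lambda>z v. 0"])

lemma smooth_prod: "(\<And>i. i \<in> I \<Longrightarrow> smooth (f i)) \<Longrightarrow> smooth (\<lambda>z. \<Prod>i\<in>I. f i z)"
  by (induction I rule: infinite_finite_induct) (auto intro: smooth_const smooth_mult)

text \<open>The chain rule leaves the inner affine map unchanged and replaces the outer function by
  its derivative in the fixed direction \<open>w \<bullet> v\<close>, which is again smooth. Hence
  the compositions with this one affine map are closed under differentiation.\<close>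

lemma smooth_compose_affine:
  fixes f :: "real \<Rightarrow> real"
  assumes "smooth f"
  shows "smooth (\<lambda>z. f (c + w \<bullet> z))"
proof (rule smoothI[where P = "\<lambda>F. \<exists>f. smooth f \<and> F = (\<lambda>z. f (c + w \<bullet> z))"])
  show "\<exists>g. smooth g \<and> (\<lambda>z. f (c + w \<bullet> z)) = (\<lambda>z. g (c + w \<bullet> z))"
    using assms by blast
next
  fix F :: "'a \<Rightarrow> real"
  assume "\<exists>f. smooth f \<and> F = (\<lambda>z. f (c + w \<bullet> z))"
  then obtain g where g: "smooth g" and F: "F = (\<lambda>z. g (c + w \<bullet> z))" by blast
  have "(F has_derivative (\<lambda>v. frechet_derivative g (at (c + w \<bullet> z)) (w \<bullet> v))) (at z)" for z
    unfolding F by (rule has_derivative_compose[of "\<lambda>z. c + w \<bullet> z", where g = g])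
      (auto intro!: derivative_eq_intros smooth_has_derivative g)
  moreover have "\<exists>f. smooth f \<and> (\<lambda>z. frechet_derivative g (at (c + w \<bullet> z)) (w \<bullet> v)) = (\<lambda>z. f (c + w \<bullet> z))" for v
    using smooth_frechet_derivative[OF g] by blast
  ultimately show "\<exists>F'. (\<forall>z. (F has_derivative F' z) (at z)) \<and>
      (\<forall>v. \<exists>f. smooth f \<and> (\<lambda>z. F' z v) = (\<lambda>z. f (c + w \<bullet> z)))"
    by (intro exI[of _ "\<lambda>z v. frechet_derivative g (at (c + w \<bullet> z)) (w \<bullet> v)"]) auto
qed

text \<open>
  The polynomial factor \<open>p (1 / t)\<close> closes the family \<open>exp (- 1 / t)\<close> under differentiation.
\<close>

definition flat :: "real poly \<Rightarrow> real \<Rightarrow> real" where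
  "flat p t = (if t > 0 then poly p (1 / t) * exp (- 1 / t) else 0)"

lemma tendsto_poly_div_exp_0: "((\<lambda>y. poly p y / exp y) \<longlongrightarrow> (0::real)) at_top"
proof -
  have "((\<lambda>y. \<Sum>i\<le>degree p. coeff p i * (y ^ i / exp y)) \<longlongrightarrow> (\<Sum>i\<le>degree p. coeff p i * 0)) at_top"
    by (intro tendsto_intros tendsto_power_div_exp_0)
  then show ?thesis
    by (simp add: poly_altdef sum_divide_distrib)
qed

text \<open>For t > 0 put y = 1 / t. Differentiating p(y) exp(-y) in t multiplies the y-derivative
  by -y^2 and gives y^2 (p - p')(y) exp(-y). At t = 0 both one-sided difference quotients tend to 0,
  because the exponential dominates every polynomial.\<close>

lemma flat_has_derivative:
  "(flat p has_real_derivative flat ([:0, 0, 1:] * (p - pderiv p)) t) (at t)"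
proof (cases t "0::real" rule: linorder_cases)
  case less
  have "((\<lambda>t. 0) has_real_derivative 0) (at t)" by simp
  then have "(flat p has_real_derivative 0) (at t)"
    by (rule has_field_derivative_transform_within_open[of _ _ _ "{..<0}"])
      (use less in \<open>auto simp: flat_def\<close>)
  then show ?thesis using less by (simp add: flat_def)
next
  case greater
  have "((\<lambda>t. poly p (1 / t) * exp (- 1 / t)) has_real_derivative
      flat ([:0, 0, 1:] * (p - pderiv p)) t) (at t)"
    using greater unfolding flat_def
    by (auto intro!: derivative_eq_intros DERIV_chain2[OF poly_DERIV] simp: field_simps power2_eq_square)
  then show ?thesis
    by (rule has_field_derivative_transform_within_open[of _ _ _ "{0<..}"])
      (use greater in \<open>auto simp: flat_def\<close>)
next
  case equal
  \<comment> \<open>With y = 1 / h the difference quotient is y p(y) / exp y, hence the extra factor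
    \<open>[:0, 1:]\<close>.\<close>
  have "((\<lambda>h. poly ([:0, 1:] * p) (inverse h) / exp (inverse h)) \<longlongrightarrow> (0::real)) (at_right 0)"
    using tendsto_poly_div_exp_0 filterlim_inverse_at_top_right by (rule filterlim_compose)
  then have "((\<lambda>h. flat p h / h) \<longlongrightarrow> 0) (at_right 0)"
    by (rule Lim_transform_eventually)
      (auto simp: eventually_at_right_less flat_def field_simps exp_minus intro: eventually_at_rightI[of 0 1])
  moreover have "((\<lambda>h. flat p h / h) \<longlongrightarrow> 0) (at_left 0)"
    by (rule tendsto_eventually) (auto simp: flat_def intro!: eventually_at_leftI[of "-1"])
  ultimately have "((\<lambda>h. flat p h / h) \<longlongrightarrow> 0) (at 0)"
    by (auto intro: filterlim_split_at)
  then show ?thesis using equal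
    by (simp add: has_field_derivative_iff flat_def)
qed

lemma smooth_flat: "smooth (flat p)"
proof (rule smoothI[where P = "\<lambda>f. \<exists>p. f = flat p"])
  fix f :: "real \<Rightarrow> real" assume "\<exists>p. f = flat p"
  then obtain p where f: "f = flat p" ..
  define q where "q = [:0, 0, 1:] * (p - pderiv p)"
  \<comment> \<open>The direction v is absorbed into the polynomial, so that the directional
    derivative stays in the family \<open>flat\<close>.\<close>
  have "(f has_derivative (\<lambda>v. flat (smult v q) t)) (at t)" for t
  proof -
    have "(*) (flat q t) = (\<lambda>v. flat (smult v q) t)"
      by (auto simp: flat_def fun_eq_iff)
    with flat_has_derivative[of p t] show ?thesis
      by (simp add: has_field_derivative_def f q_def)
  qed
  then show "\<exists>f'. (\<forall>z. (f has_derivative f' z) (at z)) \<and> (\<forall>v. \<exists>p. (\<lambda>z. f' z v) = flat p)"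
    by (intro exI[of _ "\<lambda>t v. flat (smult v q) t"]) auto
qed blast

section \<open>Smooth cutoffs of boxes\<close>

text \<open>The factor k > 0 sets the steepness. As k grows, exp(-1 / (k s)) tends to 1 for every s
  > 0, so the cutoffs tend to the indicator of the open interval; with k = 1 they serve as profiles
  of the pulses.\<close>

definition cutoff :: "real \<Rightarrow> real \<Rightarrow> real \<Rightarrow> real \<Rightarrow> real" where
  "cutoff k a b t = flat 1 (k * (t - a)) * flat 1 (k * (b - t))"

lemma smooth_cutoff: "smooth (cutoff k a b)"
proof -
  have "smooth (\<lambda>t. flat 1 (- k * a + k \<bullet> t) * flat 1 (k * b + (- k) \<bullet> t))"
    by (intro smooth_mult smooth_compose_affine smooth_flat)
  then show ?thesis
    by (simp add: cutoff_def[abs_def] algebra_simps)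
qed

lemma flat_1_bounds: "0 \<le> flat 1 t" "flat 1 t \<le> 1"
  by (auto simp: flat_def)

lemma cutoff_bounds: "0 \<le> cutoff k a b t" "cutoff k a b t \<le> 1"
  by (auto simp: cutoff_def flat_1_bounds intro: mult_le_one)

lemma cutoff_pos: "k > 0 \<Longrightarrow> a < t \<Longrightarrow> t < b \<Longrightarrow> cutoff k a b t > 0"
  by (simp add: cutoff_def flat_def)

lemma cutoff_eq_0: "k > 0 \<Longrightarrow> \<not> (a < t \<and> t < b) \<Longrightarrow> cutoff k a b t = 0"
  by (auto simp: cutoff_def flat_def zero_less_mult_iff)

lemma flat_tendsto_indicator:
  "(\<lambda>n. flat 1 (real (Suc n) * s)) \<longlonglongrightarrow> indicator {0<..} s"
proof (cases "s > 0")
  case True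
  have "(\<lambda>n. exp (- ((1 / s) * inverse (real (Suc n))))) \<longlonglongrightarrow> exp (- ((1 / s) * 0))"
    by (intro tendsto_intros LIMSEQ_inverse_real_of_nat)
  moreover have "flat 1 (real (Suc n) * s) = exp (- ((1 / s) * inverse (real (Suc n))))" for n
    using True by (simp add: flat_def zero_less_mult_iff divide_inverse)
  ultimately show ?thesis
    using True by simp
next
  case False
  then have "flat 1 (real (Suc n) * s) = 0" for n
    by (simp add: flat_def zero_less_mult_iff)
  with False show ?thesis by simp
qed

lemma cutoff_tendsto_indicator:
  "(\<lambda>n. cutoff (real (Suc n)) a b t) \<longlonglongrightarrow> indicator {a<..<b} t"
proof -
  have "(\<lambda>n. cutoff (real (Suc n)) a b t) \<longlonglongrightarrow> indicator {0<..} (t - a) * indicator {0<..} (b - t)"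
    unfolding cutoff_def by (intro tendsto_mult flat_tendsto_indicator)
  also have "indicator {0<..} (t - a) * indicator {0<..} (b - t) = (indicator {a<..<b} t :: real)"
    by (auto simp: indicator_def)
  finally show ?thesis .
qed

definition box_cutoff :: "real \<Rightarrow> 'a::euclidean_space \<Rightarrow> 'a \<Rightarrow> 'a \<Rightarrow> real" where
  "box_cutoff k a b z = (\<Prod>i\<in>Basis. cutoff k (a \<bullet> i) (b \<bullet> i) (z \<bullet> i))"

lemma smooth_box_cutoff: "smooth (box_cutoff k a b)"
proof -
  have "smooth (\<lambda>z. \<Prod>i\<in>Basis. cutoff k (a \<bullet> i) (b \<bullet> i) (0 + i \<bullet> z))"
    by (intro smooth_prod smooth_compose_affine smooth_cutoff)
  then show ?thesis
    by (simp add: box_cutoff_def[abs_def] inner_commute)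
qed

lemma box_cutoff_bounds: "0 \<le> box_cutoff k a b z" "box_cutoff k a b z \<le> 1"
  by (auto simp: box_cutoff_def cutoff_bounds intro: prod_nonneg prod_le_1)

lemma box_cutoff_eq_0: "k > 0 \<Longrightarrow> z \<notin> cbox a b \<Longrightarrow> box_cutoff k a b z = 0"
  unfolding box_cutoff_def
  by (rule prod_zero) (auto simp: mem_box not_le intro!: bexI cutoff_eq_0)

lemma box_cutoff_tendsto_indicator:
  "(\<lambda>n. box_cutoff (real (Suc n)) a b z) \<longlonglongrightarrow> indicator (box a b) z"
proof -
  have "(\<lambda>n. box_cutoff (real (Suc n)) a b z) \<longlonglongrightarrow> (\<Prod>i\<in>Basis. indicator {a \<bullet> i<..<b \<bullet> i} (z \<bullet> i))"
    unfolding box_cutoff_def by (intro tendsto_prod cutoff_tendsto_indicator)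
  also have "(\<Prod>i\<in>Basis. indicator {a \<bullet> i<..<b \<bullet> i} (z \<bullet> i)) = (indicator (box a b) z :: real)"
  proof (cases "z \<in> box a b")
    case False
    then obtain i where "i \<in> Basis" "indicator {a \<bullet> i<..<b \<bullet> i} (z \<bullet> i) = (0::real)"
      by (auto simp: mem_box indicator_def)
    then have "(\<Prod>i\<in>Basis. indicator {a \<bullet> i<..<b \<bullet> i} (z \<bullet> i)) = (0::real)"
      by (intro prod_zero) auto
    with False show ?thesis by simp
  qed (simp add: mem_box)
  finally show ?thesis .
qed

lemma test_function_box_cutoff:
  assumes "k > 0" "cbox a b \<subseteq> \<Omega>"
  shows "test_function \<Omega> (box_cutoff k a b)"
proof -
  have "closure {z. box_cutoff k a b z \<noteq> 0} \<subseteq> cbox a b"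
    using box_cutoff_eq_0[OF assms(1)] by (intro closure_minimal) auto
  with assms show ?thesis
    unfolding test_function_def
    by (auto simp: smooth_box_cutoff compact_eq_bounded_closed intro: bounded_subset[OF bounded_cbox])
qed

section \<open>Uniqueness of weak derivatives\<close>

text \<open>A countable cover by Borel sets of finite measure keeps this property in the completion.
  The criterion \<open>density_zero\<close> is applied in this measure below.\<close>

lemma sigma_finite_lebesgue: "sigma_finite_measure (lebesgue :: 'a::euclidean_space measure)"
proof
  obtain A :: "'a set set" where A: "countable A" "A \<subseteq> sets lborel" "\<Union>A = space lborel"
      "\<forall>a\<in>A. emeasure lborel a \<noteq> \<infinity>"
    using lborel.sigma_finite_countable by blast
  then have "A \<subseteq> sets lebesgue" "\<forall>a\<in>A. emeasure lebesgue a \<noteq> \<infinity>"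
    by (auto simp: subset_eq)
  with A show "\<exists>A::'a set set. countable A \<and> A \<subseteq> sets lebesgue \<and> \<Union>A = space lebesgue \<and>
      (\<forall>a\<in>A. emeasure lebesgue a \<noteq> \<infinity>)"
    by (intro exI[of _ A]) simp
qed

text \<open>Open boxes are stable under intersection and generate the Borel sets, and the sets over
  which \<open>h\<close> integrates to 0 are closed under complements and countable disjoint unions.
  So all Borel integrals vanish. Every Lebesgue set is a Borel set up to a null set, and a function
  whose integrals over all measurable sets vanish is 0 almost everywhere.\<close>

lemma integral_boxes_zero_imp_AE_zero:
  fixes h :: "'a::euclidean_space \<Rightarrow> complex"
  assumes h: "integrable lebesgue h"
    and box0: "\<And>l u. (LINT z|lebesgue. indicator (box l u) z *\<^sub>R h z) = 0"
  shows "AE z in lebesgue. h z = 0"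
proof -
  have hA: "integrable lebesgue (\<lambda>z. indicator A z *\<^sub>R h z)" if "A \<in> sets lebesgue" for A
    using that h by (rule integrable_mult_indicator)
  \<comment> \<open>The whole space is exhausted by boxes; this value is what the complement step of
    the induction uses.\<close>
  have UNIV0: "(LINT z|lebesgue. h z) = 0"
  proof -
    have "(\<lambda>n. LINT z|lebesgue. indicator (box (- (real n *\<^sub>R One)) (real n *\<^sub>R One)) z *\<^sub>R h z)
        \<longlonglongrightarrow> (LINT z|lebesgue. h z)"
    proof (rule integral_dominated_convergence[where w = "\<lambda>z. norm (h z)"])
      show "AE z in lebesgue. (\<lambda>n. indicator (box (- (real n *\<^sub>R One)) (real n *\<^sub>R One)) z *\<^sub>R h z) \<longlonglongrightarrow> h z"
      proof (rule AE_I2, rule tendsto_eventually)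
        fix z :: 'a
        obtain N where N: "z \<in> box (- (real N *\<^sub>R One)) (real N *\<^sub>R One)"
          using UN_box_eq_UNIV by blast
        show "\<forall>\<^sub>F n in sequentially. indicator (box (- (real n *\<^sub>R One)) (real n *\<^sub>R One)) z *\<^sub>R h z = h z"
          using eventually_ge_at_top[of N]
        proof eventually_elim
          case (elim n)
          then have "real N \<le> real n" by simp
          with N have "z \<in> box (- (real n *\<^sub>R One)) (real n *\<^sub>R One)"
            by (fastforce simp: mem_box)
          then show ?case by simp
        qed
      qed
    qed (use h in \<open>auto intro!: borel_measurable_integrable[OF hA] split: split_indicator\<close>)
    then show ?thesis
      by (simp add: box0 LIMSEQ_const_iff)
  qed
  have borel0: "(LINT z|lebesgue. indicator A z *\<^sub>R h z) = 0" if "A \<in> sets borel" for A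
  proof -
    have "Int_stable (range (\<lambda>(a, b). box a b :: 'a set))"
      by (auto simp: Int_stable_def box_Int_box)
    moreover have "range (\<lambda>(a, b). box a b :: 'a set) \<subseteq> Pow UNIV" by auto
    moreover have "A \<in> sigma_sets UNIV (range (\<lambda>(a, b). box a b))"
      using that unfolding borel_eq_box by simp
    ultimately show ?thesis
    proof (induction rule: sigma_sets_induct_disjoint)
      case (basic A)
      then show ?case using box0 by auto
    next
      case empty
      then show ?case by simp
    next
      case (compl A)
      then have A: "A \<in> sets lebesgue"
        by (simp add: borel_eq_box)
      have "indicator (UNIV - A) z *\<^sub>R h z = h z - indicator A z *\<^sub>R h z" for z
        by (auto simp: indicator_def)
      then show ?case
        using h hA[OF A] UNIV0 compl by simp
    next
      case (union F)
      then have F: "F i \<in> sets lebesgue" for i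
        using union(2) by (simp add: borel_eq_box image_subset_iff)
      have "set_lebesgue_integral lebesgue (\<Union>i. F i) h = (\<Sum>i. set_lebesgue_integral lebesgue (F i) h)"
        using union(1) F h
        by (intro lebesgue_integral_countable_add)
          (auto simp: disjoint_family_on_def set_integrable_def intro!: hA sets.countable_UN)
      then show ?case
        using union.IH by (simp add: set_lebesgue_integral_def)
    qed
  qed
  interpret sigma_finite_measure lebesgue by (rule sigma_finite_lebesgue)
  show ?thesis
  proof (rule density_zero[OF h])
    fix A :: "'a set" assume A: "A \<in> sets lebesgue"
    then obtain S N N' where S: "A = S \<union> N" "N \<subseteq> N'" "N' \<in> null_sets lborel" "S \<in> sets lborel"
      by (rule sets_completionE)
    have S': "S \<in> sets lebesgue"
      using S(4) by simp
    have "AE z in lebesgue. z \<notin> N'"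
      by (intro AE_not_in null_sets_completionI S)
    then have "AE z in lebesgue. indicator A z *\<^sub>R h z = indicator S z *\<^sub>R h z"
      by eventually_elim (use S in \<open>auto simp: indicator_def\<close>)
    then have "(LINT z|lebesgue. indicator A z *\<^sub>R h z) = (LINT z|lebesgue. indicator S z *\<^sub>R h z)"
      using hA[OF A] hA[OF S'] by (intro integral_cong_AE borel_measurable_integrable)
    with S borel0 show "set_lebesgue_integral lebesgue A h = 0"
      by (simp add: set_lebesgue_integral_def)
  qed
qed

text \<open>The fundamental lemma of the calculus of variations. Smooth cutoffs of a box tend to its
  indicator, so dominated convergence carries orthogonality over to integrals over boxes whose
  closure lies in \<Omega>. This makes the function vanish almost everywhere on each such box, and
  countably many of them cover \<Omega>.\<close>

lemma AE_zero_if_orthogonal_to_test_functions: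
  fixes g :: "'a::euclidean_space \<Rightarrow> complex"
  assumes "open \<Omega>" and g: "square_integrable_on g \<Omega>"
    and orth: "\<And>\<psi>. test_function \<Omega> \<psi> \<Longrightarrow> (LINT z|lebesgue_on \<Omega>. \<psi> z *\<^sub>R g z) = 0"
  shows "AE z in lebesgue_on \<Omega>. g z = 0"
proof -
  define G where "G z = indicat_real \<Omega> z *\<^sub>R g z" for z
  have \<Omega>: "\<Omega> \<inter> space lebesgue \<in> sets lebesgue"
    using \<open>open \<Omega>\<close> by simp
  have G[measurable]: "G \<in> borel_measurable lebesgue"
    using g unfolding square_integrable_on_def G_def
    by (simp add: borel_measurable_restrict_space_iff[OF \<Omega>])
  have "integrable lebesgue (\<lambda>z. indicat_real \<Omega> z *\<^sub>R (norm (g z))\<^sup>2)"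
    using g unfolding square_integrable_on_def by (simp add: integrable_restrict_space[OF \<Omega>])
  also have "(\<lambda>z. indicat_real \<Omega> z *\<^sub>R (norm (g z))\<^sup>2) = (\<lambda>z. (norm (G z))\<^sup>2)"
    by (auto simp: G_def indicator_def)
  finally have G2: "integrable lebesgue (\<lambda>z. (norm (G z))\<^sup>2)" .
  \<comment> \<open>On a box, which has finite measure, square integrability implies integrability
    through t <= 1 + t^2.\<close>
  have Gbox: "integrable lebesgue (\<lambda>z. indicat_real (cbox a b) z *\<^sub>R G z)" for a b
  proof (rule Bochner_Integration.integrable_bound)
    have "cbox a b \<in> lmeasurable" by simp
    then have "integrable lebesgue (indicat_real (cbox a b))"
      by (simp add: fmeasurable_def)
    with G2 show "integrable lebesgue (\<lambda>z. indicat_real (cbox a b) z + (norm (G z))\<^sup>2)"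
      by simp
    have "norm (G z) \<le> 1 + (norm (G z))\<^sup>2" for z
      using zero_le_power2[of "norm (G z) - 1 / 2"] by (simp add: power2_diff power_divide)
    then show "AE z in lebesgue. norm (indicat_real (cbox a b) z *\<^sub>R G z)
        \<le> norm (indicat_real (cbox a b) z + (norm (G z))\<^sup>2)"
      by (intro AE_I2) (simp add: indicator_def)
    show "(\<lambda>z. indicat_real (cbox a b) z *\<^sub>R G z) \<in> borel_measurable lebesgue"
      by (intro borel_measurable_scaleR borel_measurable_indicator G) simp
  qed
  have box0: "(LINT z|lebesgue. indicat_real (box a b) z *\<^sub>R G z) = 0" if ab: "cbox a b \<subseteq> \<Omega>" for a b
  proof -
    have "(\<lambda>n. LINT z|lebesgue. box_cutoff (real (Suc n)) a b z *\<^sub>R G z)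
        \<longlonglongrightarrow> (LINT z|lebesgue. indicat_real (box a b) z *\<^sub>R G z)"
    proof (rule integral_dominated_convergence[where w = "\<lambda>z. norm (indicat_real (cbox a b) z *\<^sub>R G z)"])
      show "(\<lambda>z. indicat_real (box a b) z *\<^sub>R G z) \<in> borel_measurable lebesgue"
        by (intro borel_measurable_scaleR borel_measurable_indicator G) simp
      have "box_cutoff (real (Suc n)) a b \<in> borel_measurable borel" for n
        by (intro borel_measurable_continuous_onI smooth_continuous_on smooth_box_cutoff)
      then show "(\<lambda>z. box_cutoff (real (Suc n)) a b z *\<^sub>R G z) \<in> borel_measurable lebesgue" for n
        by (intro borel_measurable_scaleR G) (simp add: measurable_completion)
      show "integrable lebesgue (\<lambda>z. norm (indicat_real (cbox a b) z *\<^sub>R G z))"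
        by (rule integrable_norm[OF Gbox])
      show "AE z in lebesgue. (\<lambda>n. box_cutoff (real (Suc n)) a b z *\<^sub>R G z)
          \<longlonglongrightarrow> indicat_real (box a b) z *\<^sub>R G z"
        by (intro AE_I2 tendsto_intros box_cutoff_tendsto_indicator)
      show "AE z in lebesgue. norm (box_cutoff (real (Suc n)) a b z *\<^sub>R G z)
          \<le> norm (indicat_real (cbox a b) z *\<^sub>R G z)" for n
      proof (rule AE_I2)
        fix z
        show "norm (box_cutoff (real (Suc n)) a b z *\<^sub>R G z) \<le> norm (indicat_real (cbox a b) z *\<^sub>R G z)"
          using box_cutoff_bounds[of "real (Suc n)" a b z] box_cutoff_eq_0[of "real (Suc n)" z a b]
          by (cases "z \<in> cbox a b") (auto intro: mult_left_le_one_le)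
      qed
    qed
    moreover have "(LINT z|lebesgue. box_cutoff (real (Suc n)) a b z *\<^sub>R G z) = 0" for n
    proof -
      have "(LINT z|lebesgue_on \<Omega>. box_cutoff (real (Suc n)) a b z *\<^sub>R g z) = 0"
        using ab by (intro orth test_function_box_cutoff) auto
      then show ?thesis
        by (simp add: integral_restrict_space[OF \<Omega>] G_def scaleR_left_commute mult.commute)
    qed
    ultimately show ?thesis
      by (simp add: LIMSEQ_const_iff)
  qed
  have cbox0: "AE z in lebesgue. z \<in> cbox c d \<longrightarrow> G z = 0" if cd: "cbox c d \<subseteq> \<Omega>" for c d
  proof -
    have "AE z in lebesgue. indicat_real (box c d) z *\<^sub>R G z = 0"
    proof (rule integral_boxes_zero_imp_AE_zero)
      have "integrable lebesgue (\<lambda>z. indicat_real (box c d) z *\<^sub>R indicat_real (cbox c d) z *\<^sub>R G z)"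
        by (rule integrable_mult_indicator[OF _ Gbox]) simp
      also have "(\<lambda>z. indicat_real (box c d) z *\<^sub>R indicat_real (cbox c d) z *\<^sub>R G z)
          = (\<lambda>z. indicat_real (box c d) z *\<^sub>R G z)"
        using box_subset_cbox[of c d] by (auto simp: indicator_def fun_eq_iff)
      finally show "integrable lebesgue (\<lambda>z. indicat_real (box c d) z *\<^sub>R G z)" .
    next
      fix l u
      \<comment> \<open>The same corners describe both intersections: the open one is the domain of
        integration, the closed one shows that \<open>box0\<close> applies, as it lies in
        \<open>cbox c d\<close> and hence in \<Omega>.\<close>
      obtain m M where mM: "box l u \<inter> box c d = box m M" "cbox l u \<inter> cbox c d = cbox m M"
        using box_Int_box[of l u c d] Int_interval[of l u c d] by blast
      then have "(LINT z|lebesgue. indicat_real (box m M) z *\<^sub>R G z) = 0"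
        using cd by (intro box0) blast
      also have "(\<lambda>z. indicat_real (box m M) z *\<^sub>R G z)
          = (\<lambda>z. indicat_real (box l u) z *\<^sub>R indicat_real (box c d) z *\<^sub>R G z)"
        by (auto simp: mM(1)[symmetric] indicator_def)
      finally show "(LINT z|lebesgue. indicat_real (box l u) z *\<^sub>R indicat_real (box c d) z *\<^sub>R G z) = 0" .
    qed
    \<comment> \<open>The frontier of a box is negligible, so the result passes to the closed boxes
      used in the countable cover.\<close>
    moreover have "AE z in lebesgue. z \<notin> cbox c d - box c d"
      by (intro AE_not_in) (simp add: negligible_frontier_interval flip: negligible_iff_null_sets)
    ultimately show ?thesis
      by eventually_elim auto
  qed
  obtain \<D> where \<D>: "countable \<D>" "\<D> \<subseteq> Pow \<Omega>" "\<And>X. X \<in> \<D> \<Longrightarrow> \<exists>a b. X = cbox a b" "\<Union>\<D> = \<Omega>"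
    using open_countable_Union_open_cbox[OF \<open>open \<Omega>\<close>] by metis
  have "AE z in lebesgue. \<forall>X\<in>\<D>. z \<in> X \<longrightarrow> G z = 0"
    unfolding AE_ball_countable[OF \<D>(1)]
  proof
    fix X assume "X \<in> \<D>"
    then show "AE z in lebesgue. z \<in> X \<longrightarrow> G z = 0"
      using \<D>(2,3) cbox0 by (metis PowD subsetD)
  qed
  then have "AE z in lebesgue. z \<in> \<Omega> \<longrightarrow> g z = 0"
    by eventually_elim (use \<D>(4) in \<open>auto simp: G_def indicator_def\<close>)
  then show ?thesis
    by (simp add: AE_restrict_space_iff[OF \<Omega>])
qed

section \<open>Integrals of compactly supported and of square-integrable functions\<close>

lemma integrable_lborel_compact_support:
  fixes f :: "'a::euclidean_space \<Rightarrow> 'b::{banach, second_countable_topology}"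
  assumes "continuous_on UNIV f" "compact K" "\<And>z. z \<notin> K \<Longrightarrow> f z = 0"
  shows "integrable lborel f"
proof -
  have "(\<lambda>z. indicator K z *\<^sub>R f z) = f"
    using assms(3) by (auto simp: indicator_def)
  with borel_integrable_compact[OF assms(2), of f] show ?thesis
    using continuous_on_subset[OF assms(1)] by simp
qed

lemma integrable_lebesgue_onI:
  fixes f :: "'a::euclidean_space \<Rightarrow> 'b::{banach, second_countable_topology}"
  assumes "integrable lborel f" "\<Omega> \<in> sets lebesgue"
  shows "integrable (lebesgue_on \<Omega>) f"
  using assms by (simp add: integrable_restrict_space integrable_mult_indicator integrable_completion)

text \<open>Integrals in the definitions use the completed measure restricted to \<Omega>, whereas
  translation invariance and Fubini are applied in \<open>lborel\<close>. Extension by zero and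
  completion do not change the integral of a Borel function.\<close>

lemma integral_lebesgue_on_eq_lborel:
  fixes f :: "'a::euclidean_space \<Rightarrow> 'b::{banach, second_countable_topology}"
  assumes "f \<in> borel_measurable borel" "\<Omega> \<in> sets lebesgue" "\<And>z. z \<notin> \<Omega> \<Longrightarrow> f z = 0"
  shows "integral\<^sup>L (lebesgue_on \<Omega>) f = integral\<^sup>L lborel f"
proof -
  have "(\<lambda>z. indicator \<Omega> z *\<^sub>R f z) = f"
    using assms(3) by (auto simp: indicator_def)
  with assms(1,2) show ?thesis
    by (simp add: integral_restrict_space integral_completion)
qed

lemma square_integrable_on_compact_support:
  fixes f :: "'a::euclidean_space \<Rightarrow> complex"
  assumes "continuous_on UNIV f" "compact K" "\<And>z. z \<notin> K \<Longrightarrow> f z = 0" "\<Omega> \<in> sets lebesgue"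
  shows "square_integrable_on f \<Omega>"
  unfolding square_integrable_on_def
proof
  show "f \<in> borel_measurable (lebesgue_on \<Omega>)"
    by (intro borel_measurable_integrable integrable_lebesgue_onI integrable_lborel_compact_support[of _ K] assms)
  show "integrable (lebesgue_on \<Omega>) (\<lambda>z. (norm (f z))\<^sup>2)"
    by (intro integrable_lebesgue_onI integrable_lborel_compact_support[of _ K] assms continuous_intros)
      (simp add: assms(3))
qed

lemma square_integrable_on_add:
  assumes "square_integrable_on f \<Omega>" "square_integrable_on g \<Omega>"
  shows "square_integrable_on (\<lambda>z. f z + g z) \<Omega>"
  unfolding square_integrable_on_def
proof
  have [measurable]: "f \<in> borel_measurable (lebesgue_on \<Omega>)" "g \<in> borel_measurable (lebesgue_on \<Omega>)"
    and sq: "integrable (lebesgue_on \<Omega>) (\<lambda>z. 2 * (norm (f z))\<^sup>2 + 2 * (norm (g z))\<^sup>2)"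
    using assms by (auto simp: square_integrable_on_def)
  show "(\<lambda>z. f z + g z) \<in> borel_measurable (lebesgue_on \<Omega>)"
    by measurable
  have "(norm (f z + g z))\<^sup>2 \<le> 2 * (norm (f z))\<^sup>2 + 2 * (norm (g z))\<^sup>2" for z
  proof -
    have "(norm (f z + g z))\<^sup>2 \<le> (norm (f z) + norm (g z))\<^sup>2"
      by (intro power_mono norm_triangle_ineq) simp
    also have "\<dots> \<le> 2 * (norm (f z))\<^sup>2 + 2 * (norm (g z))\<^sup>2"
      using zero_le_power2[of "norm (f z) - norm (g z)"] unfolding power2_diff power2_sum by simp
    finally show ?thesis .
  qed
  then show "integrable (lebesgue_on \<Omega>) (\<lambda>z. (norm (f z + g z))\<^sup>2)"
    by (intro Bochner_Integration.integrable_bound[OF sq] AE_I2) (auto intro: order_trans)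
qed

lemma square_integrable_on_minus: "square_integrable_on f \<Omega> \<Longrightarrow> square_integrable_on (\<lambda>z. - f z) \<Omega>"
  by (simp add: square_integrable_on_def)

lemma test_functionE:
  assumes "test_function \<Omega> \<psi>"
  obtains K where "compact K" "K \<subseteq> \<Omega>" "\<And>z. z \<notin> K \<Longrightarrow> \<psi> z = 0" "smooth \<psi>"
proof
  show "\<And>z. z \<notin> closure {z. \<psi> z \<noteq> 0} \<Longrightarrow> \<psi> z = 0"
    using closure_subset[of "{z. \<psi> z \<noteq> 0}"] by auto
qed (use assms in \<open>auto simp: test_function_def\<close>)

text \<open>Both factors are square integrable, and 2ab <= a^2 + b^2 supplies an integrable bound
  for the product.\<close>

lemma integrable_test_function_scaleR:
  assumes "test_function \<Omega> \<psi>" "square_integrable_on g \<Omega>" "\<Omega> \<in> sets lebesgue"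
  shows "integrable (lebesgue_on \<Omega>) (\<lambda>z. \<psi> z *\<^sub>R g z)"
proof -
  obtain K where K: "compact K" "\<And>z. z \<notin> K \<Longrightarrow> \<psi> z = 0" "smooth \<psi>"
    using test_functionE[OF assms(1)] by metis
  then have "continuous_on UNIV \<psi>"
    by (simp add: smooth_continuous_on)
  then have \<psi>: "integrable (lebesgue_on \<Omega>) (\<lambda>z. (\<psi> z)\<^sup>2)" "\<psi> \<in> borel_measurable (lebesgue_on \<Omega>)"
    using assms(3) K
    by (auto intro!: integrable_lebesgue_onI integrable_lborel_compact_support[of _ K] continuous_on_power
        borel_measurable_integrable)
  then have b: "integrable (lebesgue_on \<Omega>) (\<lambda>z. (\<psi> z)\<^sup>2 + (norm (g z))\<^sup>2)"
    and m: "(\<lambda>z. \<psi> z *\<^sub>R g z) \<in> borel_measurable (lebesgue_on \<Omega>)"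
    using assms(2) by (auto simp: square_integrable_on_def)
  have "norm (\<psi> z *\<^sub>R g z) \<le> (\<psi> z)\<^sup>2 + (norm (g z))\<^sup>2" for z
  proof -
    have "2 * (\<bar>\<psi> z\<bar> * norm (g z)) \<le> (\<psi> z)\<^sup>2 + (norm (g z))\<^sup>2"
      using zero_le_power2[of "\<bar>\<psi> z\<bar> - norm (g z)"] unfolding power2_diff by simp
    moreover have "0 \<le> \<bar>\<psi> z\<bar> * norm (g z)" by simp
    ultimately show ?thesis
      unfolding norm_scaleR by linarith
  qed
  then show ?thesis
    by (intro Bochner_Integration.integrable_bound[OF b m] AE_I2) (auto intro: order_trans)
qed

text \<open>The difference of two weak derivatives is orthogonal to all test functions. This allows
  the choice made in \<open>weak_deriv\<close> to be replaced by an explicit derivative under the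
  integral.\<close>

lemma has_weak_deriv_unique:
  assumes "open \<Omega>" and g: "has_weak_deriv u g v \<Omega>" and g': "has_weak_deriv u g' v \<Omega>"
  shows "AE z in lebesgue_on \<Omega>. g z = g' z"
proof -
  have \<Omega>: "\<Omega> \<in> sets lebesgue"
    using \<open>open \<Omega>\<close> by simp
  have sq: "square_integrable_on g \<Omega>" "square_integrable_on g' \<Omega>"
    using g g' by (auto simp: has_weak_deriv_def)
  have "AE z in lebesgue_on \<Omega>. g z + - g' z = 0"
  proof (rule AE_zero_if_orthogonal_to_test_functions[OF \<open>open \<Omega>\<close>])
    show "square_integrable_on (\<lambda>z. g z + - g' z) \<Omega>"
      by (intro square_integrable_on_add square_integrable_on_minus sq)
    fix \<psi> assume \<psi>: "test_function \<Omega> \<psi>"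
    have "- (LINT z|lebesgue_on \<Omega>. \<psi> z *\<^sub>R g z) = - (LINT z|lebesgue_on \<Omega>. \<psi> z *\<^sub>R g' z)"
      using g g' \<psi> unfolding has_weak_deriv_def by metis
    then show "(LINT z|lebesgue_on \<Omega>. \<psi> z *\<^sub>R (g z + - g' z)) = 0"
      using integrable_test_function_scaleR[OF \<psi> sq(1) \<Omega>] integrable_test_function_scaleR[OF \<psi> sq(2) \<Omega>]
      by (simp add: scaleR_diff_right)
  qed
  then show ?thesis by simp
qed

section \<open>Weak derivatives of differentiable functions\<close>

text \<open>The complement of \<open>K\<close> is open, so \<open>w\<close> is identically 0 near
  \<open>z\<close>.\<close>

lemma has_derivative_eq_0_outside:
  assumes "(w has_derivative w') (at z)" "closed K" "z \<notin> K" "\<And>y. y \<notin> K \<Longrightarrow> w y = 0"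
  shows "w' v = 0"
proof -
  have "((\<lambda>y. 0) has_derivative w') (at z)"
    by (rule has_derivative_transform_within_open[OF assms(1), of "- K"]) (use assms in auto)
  then have "w' = (\<lambda>v. 0)"
    by (rule has_derivative_unique) simp
  then show ?thesis by simp
qed

text \<open>The integral of the derivative is the limit of the integrals of difference quotients, by
  dominated convergence, and the latter integrals all vanish.\<close>

lemma integral_directional_derivative_eq_0:
  fixes w :: "'a::euclidean_space \<Rightarrow> 'b::euclidean_space"
  assumes deriv: "\<And>z. (w has_derivative w' z) (at z)"
    and cont: "continuous_on UNIV (\<lambda>z. w' z v)"
    and K: "compact K" "\<And>z. z \<notin> K \<Longrightarrow> w z = 0"
  shows "(LINT z|lborel. w' z v) = 0"
proof -
  have w'0: "w' z v = 0" if "z \<notin> K" for z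
    using deriv compact_imp_closed[OF K(1)] that K(2) by (rule has_derivative_eq_0_outside)
  have w: "continuous_on UNIV w"
    using deriv has_derivative_continuous continuous_at_imp_continuous_on by blast
  obtain B where B: "\<And>z. norm (w' z v) \<le> B" "B \<ge> 0"
  proof -
    have "compact ((\<lambda>z. w' z v) ` K)"
      using cont K(1) continuous_on_subset by (blast intro: compact_continuous_image)
    then obtain B where "\<forall>y\<in>(\<lambda>z. w' z v) ` K. norm y \<le> B"
      using compact_imp_bounded bounded_iff by blast
    \<comment> \<open>Off \<open>K\<close> the derivative is 0; the maximum keeps the bound valid
      there even if \<open>K\<close> is empty and \<open>B\<close> negative.\<close>
    then have "norm (w' z v) \<le> max B 0" for z
      using w'0[of z] by (cases "z \<in> K") (auto simp: le_max_iff_disj)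
    then show ?thesis using that[of "max B 0"] by auto
  qed
  obtain R where R: "\<And>z. z \<in> K \<Longrightarrow> norm z \<le> R"
    using compact_imp_bounded[OF K(1)] unfolding bounded_iff by blast
  \<comment> \<open>By translation invariance the difference quotients have integral \<open>0\<close>.\<close>
  define q where "q n z = real (Suc n) *\<^sub>R (w (inverse (real (Suc n)) *\<^sub>R v + z) - w z)" for n z
  have shift: "integrable lborel (\<lambda>z. w (c + z))" "(LINT z|lborel. w (c + z)) = (LINT z|lborel. w z)" for c
  proof -
    have "integrable lborel w"
      using w K by (rule integrable_lborel_compact_support)
    moreover have "lborel = distr lborel borel ((+) c)"
      by (simp add: lborel_distr_plus)
    moreover have "w \<in> borel_measurable borel"
      using w by (rule borel_measurable_continuous_onI)
    ultimately show "integrable lborel (\<lambda>z. w (c + z))" "(LINT z|lborel. w (c + z)) = (LINT z|lborel. w z)"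
      using integrable_distr_eq[of "(+) c" lborel borel w] integral_distr[of "(+) c" lborel borel w]
      by simp_all
  qed
  \<comment> \<open>The mean value inequality bounds the quotients by \<open>B\<close>. As the step
    length is at most 1, they vanish outside the ball of radius \<open>R + norm v\<close>.\<close>
  have "(\<lambda>n. LINT z|lborel. q n z) \<longlonglongrightarrow> (LINT z|lborel. w' z v)"
  proof (rule integral_dominated_convergence[where w = "\<lambda>z. indicator (cball 0 (R + norm v)) z *\<^sub>R B"])
    show "(\<lambda>z. w' z v) \<in> borel_measurable lborel"
      using cont by (simp add: borel_measurable_continuous_onI)
    show "q n \<in> borel_measurable lborel" for n
      unfolding q_def using shift[of 0] shift[of "inverse (real (Suc n)) *\<^sub>R v"] by auto
    show "integrable lborel (\<lambda>z. indicator (cball 0 (R + norm v)) z *\<^sub>R B)"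
      by (intro borel_integrable_compact) auto
    show "AE z in lborel. (\<lambda>n. q n z) \<longlonglongrightarrow> w' z v"
    proof (rule AE_I2)
      fix z
      have "((\<lambda>t. w (z + t *\<^sub>R v)) has_derivative (\<lambda>t. w' z (t *\<^sub>R v))) (at 0)"
        using deriv[of z] by (intro has_derivative_compose[of "\<lambda>t. z + t *\<^sub>R v" _ 0 UNIV w])
          (auto intro!: derivative_eq_intros)
      moreover have "(\<lambda>t. w' z (t *\<^sub>R v)) = (\<lambda>t. t *\<^sub>R w' z v)"
        using deriv[of z] by (simp add: has_derivative_def bounded_linear.linear linear_scale)
      ultimately have lim: "(\<lambda>h. norm (w (z + h *\<^sub>R v) - w z - h *\<^sub>R w' z v) / norm h) \<midarrow>0\<rightarrow> 0"
        by (simp add: has_derivative_at)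
      have "filterlim (\<lambda>n. inverse (real (Suc n))) (at 0) sequentially"
        unfolding filterlim_at using LIMSEQ_inverse_real_of_nat by auto
      from filterlim_compose[OF lim this]
      have "(\<lambda>n. norm (w (z + inverse (real (Suc n)) *\<^sub>R v) - w z - inverse (real (Suc n)) *\<^sub>R w' z v)
          / norm (inverse (real (Suc n)))) \<longlonglongrightarrow> 0" .
      moreover have "norm (w (z + inverse (real (Suc n)) *\<^sub>R v) - w z - inverse (real (Suc n)) *\<^sub>R w' z v)
          / norm (inverse (real (Suc n))) = norm (q n z - w' z v)" for n
      proof -
        have "q n z - w' z v = real (Suc n) *\<^sub>R
            (w (z + inverse (real (Suc n)) *\<^sub>R v) - w z - inverse (real (Suc n)) *\<^sub>R w' z v)"
          by (simp add: q_def add.commute scaleR_diff_right)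
        then have "norm (q n z - w' z v) = real (Suc n) *
            norm (w (z + inverse (real (Suc n)) *\<^sub>R v) - w z - inverse (real (Suc n)) *\<^sub>R w' z v)"
          by (simp only: norm_scaleR abs_of_nat)
        then show ?thesis
          by (simp add: divide_inverse mult.commute)
      qed
      ultimately show "(\<lambda>n. q n z) \<longlonglongrightarrow> w' z v"
        by (simp add: Lim_null[of _ "w' z v"] tendsto_norm_zero_iff)
    qed
    show "AE z in lborel. norm (q n z) \<le> indicator (cball 0 (R + norm v)) z *\<^sub>R B" for n
    proof (rule AE_I2)
      fix z
      define t where "t = inverse (real (Suc n))"
      have t: "0 < t" "t \<le> 1"
        by (auto simp: t_def inverse_le_1_iff)
      show "norm (q n z) \<le> indicator (cball 0 (R + norm v)) z *\<^sub>R B"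
      proof (cases "z \<in> cball 0 (R + norm v)")
        case True
        have "norm (w (z + t *\<^sub>R v) - w (z + 0 *\<^sub>R v)) \<le> B * norm (t - 0)"
        proof (rule differentiable_bound[where f' = "\<lambda>s r. w' (z + s *\<^sub>R v) (r *\<^sub>R v)" and S = UNIV])
          show "((\<lambda>s. w (z + s *\<^sub>R v)) has_derivative (\<lambda>r. w' (z + s *\<^sub>R v) (r *\<^sub>R v))) (at s within UNIV)" for s
            using deriv by (intro has_derivative_compose[of "\<lambda>s. z + s *\<^sub>R v" _ s UNIV w])
              (auto intro!: derivative_eq_intros)
          show "onorm (\<lambda>r. w' (z + s *\<^sub>R v) (r *\<^sub>R v)) \<le> B" for s
          proof (rule onorm_bound)
            fix r :: real
            have "w' (z + s *\<^sub>R v) (r *\<^sub>R v) = r *\<^sub>R w' (z + s *\<^sub>R v) v"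
              using deriv has_derivative_linear linear_scale by blast
            then show "norm (w' (z + s *\<^sub>R v) (r *\<^sub>R v)) \<le> B * norm r"
              using B(1)[of "z + s *\<^sub>R v"] by (simp add: mult.commute[of B] mult_left_mono)
          qed fact
        qed auto
        moreover have "norm (q n z) = norm (w (z + t *\<^sub>R v) - w z) / t"
          by (simp add: q_def t_def add.commute divide_inverse mult.commute)
        ultimately show ?thesis
          using t True by (simp add: divide_le_eq)
      next
        case False
        then have "R + norm v < norm z" by simp
        moreover have "norm (t *\<^sub>R v) \<le> norm v"
          using t by (simp add: mult_left_le_one_le)
        moreover have "norm z \<le> norm (t *\<^sub>R v + z) + norm (t *\<^sub>R v)"
          using norm_triangle_ineq4[of "t *\<^sub>R v + z" "t *\<^sub>R v"] by simp
        ultimately have "R < norm z" "R < norm (t *\<^sub>R v + z)"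
          using norm_ge_zero[of v] by linarith+
        then have "z \<notin> K" "t *\<^sub>R v + z \<notin> K"
          using R[of z] R[of "t *\<^sub>R v + z"] by auto
        then have "q n z = 0"
          by (simp add: q_def K(2) t_def)
        then show ?thesis by (simp add: B)
      qed
    qed
  qed
  moreover have "(LINT z|lborel. q n z) = 0" for n
    unfolding q_def using shift[of 0] shift[of "inverse (real (Suc n)) *\<^sub>R v"] by simp
  ultimately show ?thesis
    by (simp add: LIMSEQ_const_iff)
qed

text \<open>Integration by parts: the product of \<open>u\<close> with a test function has compact
  support, so its directional derivative has integral 0, and the product rule splits this integral
  into the two required ones.\<close>

lemma has_weak_deriv_classical:
  fixes u :: "'a::euclidean_space \<Rightarrow> complex"
  assumes "open \<Omega>" and deriv: "\<And>z. (u has_derivative u' z) (at z)"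
    and cont: "continuous_on UNIV (\<lambda>z. u' z v)" and sq: "square_integrable_on (\<lambda>z. u' z v) \<Omega>"
  shows "has_weak_deriv u (\<lambda>z. u' z v) v \<Omega>"
  unfolding has_weak_deriv_def
proof (intro conjI allI impI)
  fix \<psi> assume \<psi>: "test_function \<Omega> \<psi>"
  then obtain K where K: "compact K" "K \<subseteq> \<Omega>" "\<And>z. z \<notin> K \<Longrightarrow> \<psi> z = 0" and sm: "smooth \<psi>"
    by (rule test_functionE) metis
  let ?\<psi>' = "\<lambda>z. frechet_derivative \<psi> (at z)"
  have \<Omega>: "\<Omega> \<in> sets lebesgue" using \<open>open \<Omega>\<close> by simp
  have \<psi>'0: "?\<psi>' z v = 0" if "z \<notin> K" for z
    using smooth_has_derivative[OF sm] compact_imp_closed[OF K(1)] that K(3) by (rule has_derivative_eq_0_outside)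
  have u: "continuous_on UNIV u"
    using deriv has_derivative_continuous continuous_at_imp_continuous_on by blast
  have c1: "continuous_on UNIV (\<lambda>z. ?\<psi>' z v *\<^sub>R u z)" and c2: "continuous_on UNIV (\<lambda>z. \<psi> z *\<^sub>R u' z v)"
    by (intro continuous_on_scaleR smooth_continuous_on smooth_frechet_derivative sm u cont)+
  have i1: "integrable lborel (\<lambda>z. ?\<psi>' z v *\<^sub>R u z)" and i2: "integrable lborel (\<lambda>z. \<psi> z *\<^sub>R u' z v)"
    by (rule integrable_lborel_compact_support[OF c1 K(1)], simp add: \<psi>'0)
      (rule integrable_lborel_compact_support[OF c2 K(1)], simp add: K(3))
  have "(LINT z|lborel. \<psi> z *\<^sub>R u' z v + ?\<psi>' z v *\<^sub>R u z) = 0"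
  proof (rule integral_directional_derivative_eq_0[where w = "\<lambda>z. \<psi> z *\<^sub>R u z" and K = K])
    show "((\<lambda>z. \<psi> z *\<^sub>R u z) has_derivative (\<lambda>v. \<psi> z *\<^sub>R u' z v + ?\<psi>' z v *\<^sub>R u z)) (at z)" for z
      by (intro has_derivative_scaleR smooth_has_derivative sm deriv)
  qed (use c1 c2 K in \<open>auto intro: continuous_on_add\<close>)
  then have "(LINT z|lborel. ?\<psi>' z v *\<^sub>R u z) = - (LINT z|lborel. \<psi> z *\<^sub>R u' z v)"
    using i1 i2 by (simp add: add_eq_0_iff)
  moreover have "(LINT z|lebesgue_on \<Omega>. ?\<psi>' z v *\<^sub>R u z) = (LINT z|lborel. ?\<psi>' z v *\<^sub>R u z)"
    using K(2) by (intro integral_lebesgue_on_eq_lborel borel_measurable_continuous_onI c1 \<Omega>) (auto intro!: \<psi>'0)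
  moreover have "(LINT z|lebesgue_on \<Omega>. \<psi> z *\<^sub>R u' z v) = (LINT z|lborel. \<psi> z *\<^sub>R u' z v)"
    using K(2,3) by (intro integral_lebesgue_on_eq_lborel borel_measurable_continuous_onI c2 \<Omega>) auto
  ultimately show "(LINT z|lebesgue_on \<Omega>. ?\<psi>' z v *\<^sub>R u z) = - (LINT z|lebesgue_on \<Omega>. \<psi> z *\<^sub>R u' z v)"
    by simp
qed fact

lemma weak_deriv_has_weak_deriv:
  "u \<in> H1 \<Omega> \<Longrightarrow> v \<in> Basis \<Longrightarrow> has_weak_deriv u (weak_deriv \<Omega> v u) v \<Omega>"
  unfolding weak_deriv_def by (rule someI_ex[where P = "\<lambda>g. has_weak_deriv u g v \<Omega>"]) (simp add: H1_def)

lemma has_weak_deriv_smooth: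
  fixes \<psi> :: "'a::euclidean_space \<Rightarrow> real"
  assumes "smooth \<psi>" and K: "compact K" "\<And>z. z \<notin> K \<Longrightarrow> \<psi> z = 0" and "open \<Omega>"
  shows "has_weak_deriv (\<lambda>z. complex_of_real (\<psi> z)) (\<lambda>z. of_real (frechet_derivative \<psi> (at z) v)) v \<Omega>"
proof (rule has_weak_deriv_classical[OF \<open>open \<Omega>\<close>])
  show "((\<lambda>z. complex_of_real (\<psi> z)) has_derivative (\<lambda>v. of_real (frechet_derivative \<psi> (at z) v))) (at z)" for z
    by (intro has_derivative_of_real smooth_has_derivative assms)
  show c: "continuous_on UNIV (\<lambda>z. complex_of_real (frechet_derivative \<psi> (at z) v))"
    by (intro continuous_on_of_real smooth_continuous_on smooth_frechet_derivative assms)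
  have "frechet_derivative \<psi> (at z) v = 0" if "z \<notin> K" for z
    using smooth_has_derivative[OF \<open>smooth \<psi>\<close>] compact_imp_closed[OF K(1)] that K(2)
    by (rule has_derivative_eq_0_outside)
  then show "square_integrable_on (\<lambda>z. complex_of_real (frechet_derivative \<psi> (at z) v)) \<Omega>"
    using \<open>open \<Omega>\<close> by (intro square_integrable_on_compact_support[OF c K(1)]) auto
qed

lemma H1_smooth:
  fixes \<psi> :: "'a::euclidean_space \<Rightarrow> real"
  assumes "smooth \<psi>" "compact K" "\<And>z. z \<notin> K \<Longrightarrow> \<psi> z = 0" "open \<Omega>"
  shows "(\<lambda>z. complex_of_real (\<psi> z)) \<in> H1 \<Omega>"
proof -
  have "square_integrable_on (\<lambda>z. complex_of_real (\<psi> z)) \<Omega>"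
    using assms by (intro square_integrable_on_compact_support[where K = K] continuous_on_of_real smooth_continuous_on) auto
  with has_weak_deriv_smooth[OF assms] show ?thesis
    unfolding H1_def by blast
qed

lemma weak_deriv_smooth:
  fixes \<psi> :: "'a::euclidean_space \<Rightarrow> real"
  assumes "smooth \<psi>" "compact K" "\<And>z. z \<notin> K \<Longrightarrow> \<psi> z = 0" "open \<Omega>" "v \<in> Basis"
  shows "AE z in lebesgue_on \<Omega>.
    weak_deriv \<Omega> v (\<lambda>z. complex_of_real (\<psi> z)) z = of_real (frechet_derivative \<psi> (at z) v)"
proof (rule has_weak_deriv_unique[OF \<open>open \<Omega>\<close>])
  show "has_weak_deriv (\<lambda>z. complex_of_real (\<psi> z))
      (weak_deriv \<Omega> v (\<lambda>z. complex_of_real (\<psi> z))) v \<Omega>"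
    using H1_smooth[OF assms(1-4)] assms(5) by (rule weak_deriv_has_weak_deriv)
  show "has_weak_deriv (\<lambda>z. complex_of_real (\<psi> z)) (\<lambda>z. of_real (frechet_derivative \<psi> (at z) v)) v \<Omega>"
    using assms(1-4) by (rule has_weak_deriv_smooth)
qed

section \<open>Positivity of the energy\<close>

lemma open_open_strip: "open (open_strip L1 e)"
  unfolding open_strip_def by (intro open_Times) auto

lemma Basis_real_prod: "(1, 0) \<in> (Basis :: (real \<times> real) set)" "(0, 1) \<in> (Basis :: (real \<times> real) set)"
  by (simp_all add: Basis_prod_def)

text \<open>The chosen weak derivatives agree almost everywhere with the classical ones, and by
  linearity the two partial derivatives add up to the derivative along the characteristic direction
  \<open>(1, 1)\<close>.\<close>

lemma cell_energy_smooth: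
  assumes sm: "\<And>e. smooth (\<psi> e)" and K: "\<And>e. compact (K e)" "\<And>e z. z \<notin> K e \<Longrightarrow> \<psi> e z = 0"
  shows "cell_energy L1 \<sigma> (\<lambda>e z. of_real (\<psi> e z)) =
    cell_integral L1 (\<lambda>e z. (frechet_derivative (\<psi> e) (at z) (1, 1))\<^sup>2 + \<sigma> * (\<psi> e z)\<^sup>2)"
  unfolding cell_energy_def cell_integral_def
proof (intro sum.cong refl integral_cong_AE)
  fix e
  let ?S = "open_strip L1 e" and ?\<phi> = "\<lambda>z. complex_of_real (\<psi> e z)"
  let ?W = "\<lambda>z. weak_deriv ?S (1, 0) ?\<phi> z + weak_deriv ?S (0, 1) ?\<phi> z"
  have S: "?S \<in> sets lebesgue" using open_open_strip by simp
  have H: "?\<phi> \<in> H1 ?S"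
    using sm K(1) K(2) open_open_strip by (rule H1_smooth)
  \<comment> \<open>The representatives in \<open>?W\<close> are arbitrary choices; their
    measurability comes from the square integrability that \<open>has_weak_deriv\<close>
    contains.\<close>
  then have "square_integrable_on ?W ?S"
    using weak_deriv_has_weak_deriv Basis_real_prod unfolding has_weak_deriv_def
    by (intro square_integrable_on_add) blast+
  then have W: "(\<lambda>z. (norm (?W z))\<^sup>2) \<in> borel_measurable (lebesgue_on ?S)"
    unfolding square_integrable_on_def by (intro borel_measurable_integrable) blast
  have m: "f \<in> borel_measurable (lebesgue_on ?S)" if "continuous_on UNIV f" for f :: "real \<times> real \<Rightarrow> real"
    using borel_measurable_continuous_onI[OF that] by (simp add: measurable_completion measurable_restrict_space1)
  have "(\<lambda>z. \<sigma> * (norm (?\<phi> z))\<^sup>2) \<in> borel_measurable (lebesgue_on ?S)"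
    by (intro m continuous_on_mult continuous_on_const continuous_on_power continuous_on_norm continuous_on_of_real
        smooth_continuous_on sm)
  with W show "(\<lambda>z. (norm (?W z))\<^sup>2 + \<sigma> * (norm (?\<phi> z))\<^sup>2) \<in> borel_measurable (lebesgue_on ?S)"
    by (rule borel_measurable_add)
  show "(\<lambda>z. (frechet_derivative (\<psi> e) (at z) (1, 1))\<^sup>2 + \<sigma> * (\<psi> e z)\<^sup>2) \<in> borel_measurable (lebesgue_on ?S)"
    by (intro m continuous_on_add continuous_on_mult continuous_on_power continuous_on_const smooth_continuous_on
        smooth_frechet_derivative sm)
  have "AE z in lebesgue_on ?S. weak_deriv ?S (1, 0) ?\<phi> z = of_real (frechet_derivative (\<psi> e) (at z) (1, 0))"
    using sm K(1) K(2) open_open_strip Basis_real_prod(1) by (rule weak_deriv_smooth)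
  moreover have "AE z in lebesgue_on ?S. weak_deriv ?S (0, 1) ?\<phi> z = of_real (frechet_derivative (\<psi> e) (at z) (0, 1))"
    using sm K(1) K(2) open_open_strip Basis_real_prod(2) by (rule weak_deriv_smooth)
  ultimately show "AE z in lebesgue_on ?S. (norm (?W z))\<^sup>2 + \<sigma> * (norm (?\<phi> z))\<^sup>2
      = (frechet_derivative (\<psi> e) (at z) (1, 1))\<^sup>2 + \<sigma> * (\<psi> e z)\<^sup>2"
  proof eventually_elim
    case (elim z)
    have "linear (frechet_derivative (\<psi> e) (at z))"
      using smooth_differentiable[OF sm] by (rule linear_frechet_derivative)
    from linear_add[OF this, of "(1, 0)" "(0, 1)"] have
      "frechet_derivative (\<psi> e) (at z) (1, 1) = frechet_derivative (\<psi> e) (at z) (1, 0) + frechet_derivative (\<psi> e) (at z) (0, 1)"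
      by simp
    with elim show ?case
      by (simp flip: of_real_add)
  qed
qed

lemma cell_energy_nonneg: "\<sigma> \<ge> 0 \<Longrightarrow> cell_energy L1 \<sigma> \<phi> \<ge> 0"
  unfolding cell_energy_def cell_integral_def by (intro sum_nonneg Bochner_Integration.integral_nonneg) simp

text \<open>The energy is a sum of integrals of nonnegative functions, so each integrand vanishes
  almost everywhere; since \<sigma> > 0, its second term then forces \<phi> to vanish.\<close>

lemma cell_energy_eq_0_imp_AE_0:
  assumes "\<phi> \<in> cell_space L1" "\<sigma> > 0" "cell_energy L1 \<sigma> \<phi> = 0"
  shows "AE z in lebesgue_on (open_strip L1 e). \<phi> e z = 0"
proof -
  let ?W = "\<lambda>e z. weak_deriv (open_strip L1 e) (1, 0) (\<phi> e) z + weak_deriv (open_strip L1 e) (0, 1) (\<phi> e) z"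
  let ?F = "\<lambda>e z. (norm (?W e z))\<^sup>2 + \<sigma> * (norm (\<phi> e z))\<^sup>2"
  have H: "\<phi> e \<in> H1 (open_strip L1 e)"
    using assms(1) by (simp add: cell_space_def)
  then have "square_integrable_on (?W e) (open_strip L1 e)" "square_integrable_on (\<phi> e) (open_strip L1 e)"
    using weak_deriv_has_weak_deriv[OF H] Basis_real_prod unfolding has_weak_deriv_def
    by (auto intro!: square_integrable_on_add simp: H1_def)
  \<comment> \<open>Integrability is essential here: the Bochner integral of a non-integrable
    density would be 0 as well, without any conclusion about \<phi>.\<close>
  then have int: "integrable (lebesgue_on (open_strip L1 e)) (?F e)"
    by (auto simp: square_integrable_on_def)
  have nonneg: "(LINT z|lebesgue_on (open_strip L1 e). ?F e z) \<ge> 0" for e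
    using assms(2) by (intro Bochner_Integration.integral_nonneg) simp
  have "\<forall>e\<in>{E0, Eplus, Eminus}. (LINT z|lebesgue_on (open_strip L1 e). ?F e z) = 0"
    using assms(3) nonneg unfolding cell_energy_def cell_integral_def
    by (subst (asm) sum_nonneg_eq_0_iff) auto
  then have "(LINT z|lebesgue_on (open_strip L1 e). ?F e z) = 0"
    by (cases e) auto
  then have "AE z in lebesgue_on (open_strip L1 e). ?F e z = 0"
    using assms(2) by (subst (asm) integral_nonneg_eq_0_iff_AE[OF int]) auto
  then show ?thesis
    by eventually_elim (use assms(2) in \<open>auto simp: add_nonneg_eq_0_iff\<close>)
qed

lemma cell_energy_pos:
  assumes "\<phi> \<in> admissible L1 p" "\<sigma> > 0"
  shows "cell_energy L1 \<sigma> \<phi> > 0"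
proof (rule ccontr)
  assume "\<not> cell_energy L1 \<sigma> \<phi> > 0"
  then have 0: "cell_energy L1 \<sigma> \<phi> = 0"
    using cell_energy_nonneg[of \<sigma> L1 \<phi>] assms(2) by simp
  have "(LINT z|lebesgue_on (open_strip L1 e). norm (\<phi> e z) powr (p + 1)) = 0" for e
    using cell_energy_eq_0_imp_AE_0[of \<phi> L1 \<sigma> e] assms 0
    by (intro integral_eq_zero_AE) (auto simp: admissible_def)
  then have "cell_integral L1 (\<lambda>e z. norm (\<phi> e z) powr (p + 1)) = 0"
    by (simp add: cell_integral_def)
  with assms(1) show False
    by (simp add: admissible_def)
qed

section \<open>Concentrating pulses\<close>

text \<open>A nonzero value requires 0 < x < l and -1/n < \<xi> - x < 1/n, and adding the two bounds
  confines \<xi> to the interval from -1/n to l + 1/n.\<close>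

lemma sheared_product_eq_0:
  fixes a b :: "real \<Rightarrow> real"
  assumes a: "\<And>x. \<not> (0 < x \<and> x < l) \<Longrightarrow> a x = 0" and b: "\<And>t. \<not> (-1 < t \<and> t < 1) \<Longrightarrow> b t = 0"
    and n: "n > 0" and z: "z \<notin> cbox (- 1 / n, 0) (l + 1 / n, l)"
  shows "a (snd z) * b (n * (fst z - snd z)) = 0"
proof (rule ccontr)
  assume "a (snd z) * b (n * (fst z - snd z)) \<noteq> 0"
  then have "0 < snd z" "snd z < l" "- 1 < n * (fst z - snd z)" "n * (fst z - snd z) < 1"
    using a[of "snd z"] b[of "n * (fst z - snd z)"] by force+
  moreover from this n have "- 1 / n < fst z - snd z" "fst z - snd z < 1 / n"
    by (subst pos_divide_less_eq pos_less_divide_eq, simp, simp add: mult.commute)+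
  ultimately have "z \<in> cbox (- 1 / n, 0) (l + 1 / n, l)"
    by (cases z) (auto simp: cbox_Pair_eq)
  with z show False ..
qed

text \<open>Fubini with the \<xi>-integral inside: for fixed x the substitution t = n (\<xi> - x)
  yields the factor 1/n and removes the dependence on x. This is the source of the 1/n in both the
  constraint and the energy.\<close>

lemma integral_sheared_product:
  fixes a b :: "real \<Rightarrow> real"
  assumes a: "continuous_on UNIV a" "\<And>x. \<not> (0 < x \<and> x < l) \<Longrightarrow> a x = 0"
    and b: "continuous_on UNIV b" "\<And>t. \<not> (-1 < t \<and> t < 1) \<Longrightarrow> b t = 0"
    and n: "n > 0"
  defines "f \<equiv> \<lambda>z. a (snd z) * b (n * (fst z - snd z))"
  shows "integrable lborel f" and "(LINT z|lborel. f z) = (LINT x|lborel. a x) * (LINT t|lborel. b t) / n"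
proof -
  have c: "continuous_on UNIV f"
    unfolding f_def using a(1) b(1)
    by (intro continuous_intros continuous_on_compose2[OF a(1)] continuous_on_compose2[OF b(1)]) auto
  show int: "integrable lborel f"
    unfolding f_def using a(2) b(2) n
    by (intro integrable_lborel_compact_support[OF c[unfolded f_def] compact_cbox] sheared_product_eq_0)
  have "(LINT z|lborel. f z) = (LINT x|lborel. LINT \<xi>|lborel. f (\<xi>, x))"
    using lborel_pair.integral_snd[of "\<lambda>\<xi> x. f (\<xi>, x)"] int by (simp add: lborel_prod)
  also have "\<dots> = (LINT x|lborel. a x * ((LINT t|lborel. b t) / n))"
  proof (rule Bochner_Integration.integral_cong[OF refl])
    fix x
    have "(LINT t|lborel. b t) = n * (LINT \<xi>|lborel. b (- n * x + n * \<xi>))"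
      using lborel_integral_real_affine[of n b "- n * x"] n by simp
    then show "(LINT \<xi>|lborel. f (\<xi>, x)) = a x * ((LINT t|lborel. b t) / n)"
      using n by (simp add: f_def right_diff_distrib)
  qed
  finally show "(LINT z|lborel. f z) = (LINT x|lborel. a x) * (LINT t|lborel. b t) / n"
    by simp
qed

text \<open>The integrand is nonnegative and positive on an interval of positive length.\<close>

lemma integral_cutoff_powr_pos:
  assumes "a < b" "q > 0"
  shows "(LINT t|lborel. cutoff 1 a b t powr q) > 0"
proof -
  have c: "continuous_on UNIV (\<lambda>t. cutoff 1 a b t powr q)"
    using assms by (intro continuous_on_powr' smooth_continuous_on smooth_cutoff continuous_on_const) (simp add: cutoff_bounds)
  have int: "integrable lborel (\<lambda>t. cutoff 1 a b t powr q)"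
    by (rule integrable_lborel_compact_support[OF c compact_Icc[of a b]]) (auto simp: cutoff_eq_0)
  have "(LINT t|lborel. cutoff 1 a b t powr q) \<noteq> 0"
  proof
    assume "(LINT t|lborel. cutoff 1 a b t powr q) = 0"
    then have "AE t in lborel. cutoff 1 a b t powr q = 0"
      by (subst (asm) integral_nonneg_eq_0_iff_AE[OF int]) auto
    then have "AE t in lborel. t \<notin> {a<..<b}"
      by eventually_elim (use cutoff_pos[of 1 a _ b] in fastforce)
    then have "emeasure lborel {a<..<b} = 0"
      by (subst (asm) AE_iff_measurable[OF _ refl]) (auto simp: greaterThanLessThan_def greaterThan_def lessThan_def Int_def)
    with assms show False by simp
  qed
  moreover have "(LINT t|lborel. cutoff 1 a b t powr q) \<ge> 0"
    by (intro Bochner_Integration.integral_nonneg) simp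
  ultimately show ?thesis by linarith
qed

text \<open>Outside the open interval, endpoints included, the cutoff attains its minimum 0, so its
  derivative vanishes there.\<close>

lemma cutoff_deriv_eq_0:
  assumes "\<not> (a < t \<and> t < b)"
  shows "frechet_derivative (cutoff 1 a b) (at t) 1 = 0"
  using smooth_real_has_derivative[OF smooth_cutoff] zero_less_one
  by (rule DERIV_local_min) (use assms in \<open>auto simp: cutoff_eq_0 cutoff_bounds\<close>)

text \<open>
  A profile carried along the characteristics \<open>\<xi> - x = const\<close> and vanishing at both ends of the edge,
  so that its extension by zero to the other two edges satisfies the vertex conditions.
\<close>

definition pulse :: "real \<Rightarrow> real \<Rightarrow> real \<times> real \<Rightarrow> real" where
  "pulse L1 n z = cutoff 1 0 L1 (snd z) * cutoff 1 (-1) 1 (n * (fst z - snd z))"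

lemma smooth_pulse: "smooth (pulse L1 n)"
proof -
  have "smooth (\<lambda>z. cutoff 1 0 L1 (0 + (0, 1) \<bullet> z) * cutoff 1 (-1) 1 (0 + (n, - n) \<bullet> z))"
    by (intro smooth_mult smooth_compose_affine smooth_cutoff)
  then show ?thesis
    by (simp add: pulse_def[abs_def] inner_prod_def right_diff_distrib)
qed

lemma pulse_eq_0: "\<not> (0 < snd z \<and> snd z < L1) \<Longrightarrow> pulse L1 n z = 0"
  by (simp add: pulse_def cutoff_eq_0)

lemma pulse_eq_0_outside_cbox:
  assumes "n > 0" "z \<notin> cbox (- 1 / n, 0) (L1 + 1 / n, L1)"
  shows "pulse L1 n z = 0"
  unfolding pulse_def using assms by (intro sheared_product_eq_0 cutoff_eq_0) auto

text \<open>The phase n (\<xi> - x) is constant along \<open>(1, 1)\<close>. Hence the term in which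
  the chain rule produces a factor n drops out, and only the derivative of the profile in x
  remains.\<close>

lemma pulse_transport_derivative:
  "frechet_derivative (pulse L1 n) (at z) (1, 1)
    = frechet_derivative (cutoff 1 0 L1) (at (snd z)) 1 * cutoff 1 (-1) 1 (n * (fst z - snd z))"
proof -
  let ?G = "frechet_derivative (cutoff 1 0 L1) (at (snd z)) 1"
    and ?H = "frechet_derivative (cutoff 1 (-1) 1) (at (n * (fst z - snd z))) 1"
  have "((\<lambda>z. cutoff 1 0 L1 (snd z)) has_derivative (\<lambda>v. ?G * snd v)) (at z)"
    by (rule has_derivative_compose[OF _ smooth_real_has_derivative[OF smooth_cutoff, THEN has_field_derivative_imp_has_derivative]])
      (auto intro!: derivative_eq_intros)
  moreover have "((\<lambda>z. cutoff 1 (-1) 1 (n * (fst z - snd z))) has_derivative (\<lambda>v. ?H * (n * (fst v - snd v)))) (at z)"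
    by (rule has_derivative_compose[OF _ smooth_real_has_derivative[OF smooth_cutoff, THEN has_field_derivative_imp_has_derivative]])
      (auto intro!: derivative_eq_intros)
  ultimately have "(pulse L1 n has_derivative (\<lambda>v. cutoff 1 0 L1 (snd z) * (?H * (n * (fst v - snd v)))
      + ?G * snd v * cutoff 1 (-1) 1 (n * (fst z - snd z)))) (at z)"
    unfolding pulse_def by (rule has_derivative_mult)
  from frechet_derivative_at[OF this] have "frechet_derivative (pulse L1 n) (at z)
      = (\<lambda>v. cutoff 1 0 L1 (snd z) * (?H * (n * (fst v - snd v))) + ?G * snd v * cutoff 1 (-1) 1 (n * (fst z - snd z)))"
    by simp
  then show ?thesis by simp
qed

text \<open>Real valued, because \<open>smooth\<close> concerns real functions;
  \<open>complex_of_real\<close> is applied where an element of \<open>cell_space\<close> is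
  formed.\<close>

definition pulse_cell :: "real \<Rightarrow> real \<Rightarrow> real \<Rightarrow> edge \<Rightarrow> real \<times> real \<Rightarrow> real" where
  "pulse_cell L1 n c e z = (if e = E0 then c * pulse L1 n z else 0)"

lemma smooth_pulse_cell: "smooth (pulse_cell L1 n c e)"
  unfolding pulse_cell_def[abs_def]
  by (cases "e = E0") (auto intro: smooth_mult smooth_const smooth_pulse)

lemma pulse_cell_eq_0_outside_cbox:
  "n > 0 \<Longrightarrow> z \<notin> cbox (- 1 / n, 0) (L1 + 1 / n, L1) \<Longrightarrow> pulse_cell L1 n c e z = 0"
  by (simp add: pulse_cell_def pulse_eq_0_outside_cbox)

lemma pulse_cell_in_cell_space:
  assumes "n > 0"
  shows "(\<lambda>e z. complex_of_real (pulse_cell L1 n c e z)) \<in> cell_space L1"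
  unfolding cell_space_def
proof (intro CollectI conjI allI ballI)
  fix e
  show "(\<lambda>z. complex_of_real (pulse_cell L1 n c e z)) \<in> H1 (open_strip L1 e)"
    using smooth_pulse_cell compact_cbox pulse_cell_eq_0_outside_cbox[OF assms] open_open_strip by (rule H1_smooth)
  show "continuous_on (closed_strip L1 e) (\<lambda>z. complex_of_real (pulse_cell L1 n c e z))"
    by (intro continuous_on_of_real smooth_continuous_on smooth_pulse_cell)
qed (auto simp: pulse_cell_def pulse_eq_0)

section \<open>The constraint and the energy of the pulses\<close>

lemma integral_open_strip_E0:
  fixes f :: "real \<times> real \<Rightarrow> real"
  assumes "integrable lborel f" "\<And>z. \<not> (0 < snd z \<and> snd z < L1) \<Longrightarrow> f z = 0"
  shows "(LINT z|lebesgue_on (open_strip L1 E0). f z) = (LINT z|lborel. f z)"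
proof (rule integral_lebesgue_on_eq_lborel)
  show "f \<in> borel_measurable borel"
    using borel_measurable_integrable[OF assms(1)] by simp
  show "open_strip L1 E0 \<in> sets lebesgue"
    using open_open_strip by simp
qed (auto intro!: assms(2) simp: open_strip_def)

text \<open>The factors are nonnegative, so the power distributes over them and leaves a sheared
  product of powers of the two profiles.\<close>

lemma integral_pulse_powr:
  fixes L1 n c q :: real
  assumes "n > 0" "c \<ge> 0" "q > 0"
  defines "S \<equiv> (LINT x|lborel. cutoff 1 0 L1 x powr q) * (LINT t|lborel. cutoff 1 (-1) 1 t powr q)"
  shows "integrable lborel (\<lambda>z. norm (complex_of_real (c * pulse L1 n z)) powr q)"
    and "(LINT z|lborel. norm (complex_of_real (c * pulse L1 n z)) powr q) = c powr q * S / n"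
proof -
  have eq: "norm (complex_of_real (c * pulse L1 n z)) powr q
      = c powr q * (cutoff 1 0 L1 (snd z) powr q * cutoff 1 (-1) 1 (n * (fst z - snd z)) powr q)" for z
    using assms(2) unfolding norm_of_real pulse_def
    by (simp add: abs_mult powr_mult cutoff_bounds)
  have c: "continuous_on UNIV (\<lambda>t. cutoff 1 a b t powr q)" for a b
    using assms by (intro continuous_on_powr' smooth_continuous_on smooth_cutoff continuous_on_const) (simp add: cutoff_bounds)
  note * = integral_sheared_product[OF c[of 0 L1] _ c[of "-1" 1] _ assms(1), of L1]
  show "integrable lborel (\<lambda>z. norm (complex_of_real (c * pulse L1 n z)) powr q)"
    unfolding eq by (intro integrable_mult_right *(1)) (auto simp: cutoff_eq_0)
  have "(LINT z|lborel. cutoff 1 0 L1 (snd z) powr q * cutoff 1 (-1) 1 (n * (fst z - snd z)) powr q) = S / n"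
    unfolding S_def by (intro *(2)) (auto simp: cutoff_eq_0)
  then show "(LINT z|lborel. norm (complex_of_real (c * pulse L1 n z)) powr q) = c powr q * S / n"
    unfolding eq by simp
qed

text \<open>The transport derivative and the pulse are both sheared products with amplitude c and
  without a growing factor n. Their squares therefore integrate to constants times c^2 / n, with
  constants that depend only on the profiles.\<close>

lemma cell_energy_pulse_cell:
  fixes L1 \<sigma> :: real
  obtains A where "\<And>n c. n > 0 \<Longrightarrow> cell_energy L1 \<sigma> (\<lambda>e z. of_real (pulse_cell L1 n c e z)) = A * c\<^sup>2 / n"
proof
  let ?g = "cutoff 1 0 L1" and ?h = "cutoff 1 (-1) 1" and ?g' = "\<lambda>t. frechet_derivative (cutoff 1 0 L1) (at t) 1"
  let ?A = "(LINT x|lborel. (?g' x)\<^sup>2) * (LINT t|lborel. (?h t)\<^sup>2) + \<sigma> * ((LINT x|lborel. (?g x)\<^sup>2) * (LINT t|lborel. (?h t)\<^sup>2))"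
  fix n c :: real
  assume n: "n > 0"
  let ?F = "\<lambda>z. (?g' (snd z))\<^sup>2 * (?h (n * (fst z - snd z)))\<^sup>2" and ?P = "\<lambda>z. (?g (snd z))\<^sup>2 * (?h (n * (fst z - snd z)))\<^sup>2"
  have c: "continuous_on UNIV (\<lambda>t. (?g t)\<^sup>2)" "continuous_on UNIV (\<lambda>t. (?h t)\<^sup>2)" "continuous_on UNIV (\<lambda>t. (?g' t)\<^sup>2)"
    by (intro continuous_on_power smooth_continuous_on smooth_frechet_derivative smooth_cutoff)+
  have F: "integrable lborel ?F" "(LINT z|lborel. ?F z) = (LINT x|lborel. (?g' x)\<^sup>2) * (LINT t|lborel. (?h t)\<^sup>2) / n"
    using integral_sheared_product[OF c(3) _ c(2) _ n, of L1] by (auto simp: cutoff_eq_0 cutoff_deriv_eq_0)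
  have P: "integrable lborel ?P" "(LINT z|lborel. ?P z) = (LINT x|lborel. (?g x)\<^sup>2) * (LINT t|lborel. (?h t)\<^sup>2) / n"
    using integral_sheared_product[OF c(1) _ c(2) _ n, of L1] by (auto simp: cutoff_eq_0)
  have D: "frechet_derivative (pulse_cell L1 n c E0) (at z) (1, 1) = c * (?g' (snd z) * ?h (n * (fst z - snd z)))" for z
  proof -
    have "((\<lambda>z. c * pulse L1 n z) has_derivative (\<lambda>v. c * frechet_derivative (pulse L1 n) (at z) v)) (at z)"
      by (intro has_derivative_mult_right smooth_has_derivative smooth_pulse)
    then have "frechet_derivative (\<lambda>z. c * pulse L1 n z) (at z) = (\<lambda>v. c * frechet_derivative (pulse L1 n) (at z) v)"
      by (rule frechet_derivative_at[symmetric])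
    then show ?thesis
      by (simp add: pulse_cell_def[abs_def] pulse_transport_derivative)
  qed
  have "cell_energy L1 \<sigma> (\<lambda>e z. of_real (pulse_cell L1 n c e z)) =
      cell_integral L1 (\<lambda>e z. (frechet_derivative (pulse_cell L1 n c e) (at z) (1, 1))\<^sup>2 + \<sigma> * (pulse_cell L1 n c e z)\<^sup>2)"
    using smooth_pulse_cell compact_cbox pulse_cell_eq_0_outside_cbox[OF n] by (rule cell_energy_smooth)
  also have "\<dots> = (LINT z|lebesgue_on (open_strip L1 E0). c\<^sup>2 * (?F z + \<sigma> * ?P z))"
  proof -
    have "frechet_derivative (pulse_cell L1 n c e) (at z) (1, 1) = 0" "pulse_cell L1 n c e z = 0" if "e \<noteq> E0" for e z
      using that by (simp_all add: pulse_cell_def[abs_def])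
    moreover have "(frechet_derivative (pulse_cell L1 n c E0) (at z) (1, 1))\<^sup>2 + \<sigma> * (pulse_cell L1 n c E0 z)\<^sup>2
        = c\<^sup>2 * (?F z + \<sigma> * ?P z)" for z
      by (simp add: D pulse_cell_def pulse_def power_mult_distrib algebra_simps)
    ultimately show ?thesis
      unfolding cell_integral_def by simp
  qed
  also have "\<dots> = (LINT z|lborel. c\<^sup>2 * (?F z + \<sigma> * ?P z))"
    using F(1) P(1) by (intro integral_open_strip_E0) (auto simp: cutoff_eq_0 cutoff_deriv_eq_0)
  also have "\<dots> = ?A * c\<^sup>2 / n"
    using F P by (simp add: add_divide_distrib algebra_simps)
  finally show "cell_energy L1 \<sigma> (\<lambda>e z. of_real (pulse_cell L1 n c e z)) = ?A * c\<^sup>2 / n" .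
qed

section \<open>The value of the infimum and its non-attainment\<close>

theorem propositionB1:
  fixes L1 L2 p \<sigma> :: real
  assumes "L1 > 0" and "L2 > 0" and "L1 + L2 = 2 * pi"
    and "p > 1" and "\<sigma> > 0"
  shows "(INF \<phi>\<in>admissible L1 p. ereal (cell_energy L1 \<sigma> \<phi>)) = 0 \<and>
    \<not> (\<exists>\<phi>\<in>admissible L1 p.
          ereal (cell_energy L1 \<sigma> \<phi>) = (INF \<phi>\<in>admissible L1 p. ereal (cell_energy L1 \<sigma> \<phi>)))"
proof -
  \<comment> \<open>The infimum is taken in \<open>ereal\<close>, where an empty admissible set
    would give infinity; the value 0 thus includes that the constraint can be met.\<close>
  let ?I = "INF \<phi>\<in>admissible L1 p. ereal (cell_energy L1 \<sigma> \<phi>)"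
  define S where "S = (LINT x|lborel. cutoff 1 0 L1 x powr (p + 1)) * (LINT t|lborel. cutoff 1 (-1) 1 t powr (p + 1))"
  have S: "S > 0"
    unfolding S_def using assms by (intro mult_pos_pos integral_cutoff_powr_pos) auto
  \<comment> \<open>The solution of \<open>c powr (p + 1) * S / real (Suc n) = 1\<close>, which is
    the constraint for the pulse with parameter \<open>real (Suc n)\<close>; the successor keeps
    that parameter positive.\<close>
  define c where "c n = (real (Suc n) / S) powr (1 / (p + 1))" for n
  define \<phi> where "\<phi> n e z = complex_of_real (pulse_cell L1 (real (Suc n)) (c n) e z)" for n e z
  obtain A where A: "\<And>n c. n > 0 \<Longrightarrow> cell_energy L1 \<sigma> (\<lambda>e z. of_real (pulse_cell L1 n c e z)) = A * c\<^sup>2 / n"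
    using cell_energy_pulse_cell[of L1 \<sigma>] by blast
  have adm: "\<phi> n \<in> admissible L1 p" for n
  proof -
    have c: "c n \<ge> 0" "c n powr (p + 1) = real (Suc n) / S"
      using assms S by (simp_all add: c_def powr_powr)
    have E0: "norm (\<phi> n E0 z) powr (p + 1) = norm (complex_of_real (c n * pulse L1 (real (Suc n)) z)) powr (p + 1)" for z
      by (simp add: \<phi>_def pulse_cell_def)
    have E: "norm (\<phi> n e z) powr (p + 1) = 0" if "e \<noteq> E0" for e z
      using that by (simp add: \<phi>_def pulse_cell_def)
    have p1: "p + 1 > 0" using assms by simp
    note I = integral_pulse_powr[of "real (Suc n)" "c n" "p + 1" L1, OF _ c(1) p1, folded S_def]
    have "integrable (lebesgue_on (open_strip L1 e)) (\<lambda>z. norm (\<phi> n e z) powr (p + 1))" for e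
    proof (cases "e = E0")
      case True
      have "integrable (lebesgue_on (open_strip L1 E0)) (\<lambda>z. norm (\<phi> n E0 z) powr (p + 1))"
        unfolding E0 using open_open_strip by (intro integrable_lebesgue_onI I) auto
      with True show ?thesis by simp
    qed (simp add: E)
    moreover have "cell_integral L1 (\<lambda>e z. norm (\<phi> n e z) powr (p + 1)) = 1"
    proof -
      have "(LINT z|lebesgue_on (open_strip L1 E0). norm (\<phi> n E0 z) powr (p + 1))
          = (LINT z|lborel. norm (complex_of_real (c n * pulse L1 (real (Suc n)) z)) powr (p + 1))"
        unfolding E0 by (rule integral_open_strip_E0) (use I(1) in \<open>auto simp: pulse_eq_0\<close>)
      also have "\<dots> = 1"
        using S by (subst I(2)) (simp_all add: c(2))
      finally show ?thesis
        by (simp add: cell_integral_def E)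
    qed
    moreover have "\<phi> n \<in> cell_space L1"
      unfolding \<phi>_def by (rule pulse_cell_in_cell_space) simp
    ultimately show ?thesis by (simp add: admissible_def)
  qed
  \<comment> \<open>This sequence is the energy \<open>A * (c n)\<^sup>2 / real (Suc n)\<close> with
    \<open>c n\<close> inserted. Its exponent 2 / (p + 1) - 1 is negative precisely because p >
    1.\<close>
  have "(\<lambda>n. A * (1 / S) powr (2 / (p + 1)) * real (Suc n) powr (2 / (p + 1) - 1)) \<longlonglongrightarrow>
      A * (1 / S) powr (2 / (p + 1)) * 0"
  proof (intro tendsto_intros)
    have "2 / (p + 1) - 1 < 0" using assms by (simp add: field_simps)
    then show "(\<lambda>n. real (Suc n) powr (2 / (p + 1) - 1)) \<longlonglongrightarrow> 0"
      by (intro tendsto_neg_powr filterlim_compose[OF filterlim_real_sequentially] filterlim_Suc)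
  qed
  moreover have "cell_energy L1 \<sigma> (\<phi> n) = A * (1 / S) powr (2 / (p + 1)) * real (Suc n) powr (2 / (p + 1) - 1)" for n
  proof -
    have "(c n)\<^sup>2 = (real (Suc n) / S) powr (2 / (p + 1))"
      unfolding c_def by (simp add: power2_eq_square flip: powr_add)
    also have "\<dots> = real (Suc n) powr (2 / (p + 1)) * (1 / S) powr (2 / (p + 1))"
      using S powr_mult[of "real (Suc n)" "1 / S"] by simp
    finally have "A * (c n)\<^sup>2 / real (Suc n)
        = A * (1 / S) powr (2 / (p + 1)) * (real (Suc n) powr (2 / (p + 1)) / real (Suc n))"
      by simp
    also have "real (Suc n) powr (2 / (p + 1)) / real (Suc n) = real (Suc n) powr (2 / (p + 1) - 1)"
      by (simp add: powr_diff)
    finally show ?thesis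
      using A[of "real (Suc n)" "c n"] unfolding \<phi>_def by simp
  qed
  ultimately have "(\<lambda>n. ereal (cell_energy L1 \<sigma> (\<phi> n))) \<longlonglongrightarrow> 0"
    by (simp add: zero_ereal_def)
  then have "?I \<le> 0"
    by (rule LIMSEQ_le_const) (use adm in \<open>auto intro: INF_lower\<close>)
  moreover have "?I \<ge> 0"
    using assms by (intro INF_greatest) (simp add: cell_energy_nonneg)
  ultimately have I: "?I = 0" by (rule antisym)
  \<comment> \<open>A minimizer would have energy 0, whereas every admissible function has positive
    energy.\<close>
  have "ereal (cell_energy L1 \<sigma> \<phi>) \<noteq> 0" if "\<phi> \<in> admissible L1 p" for \<phi>
    using cell_energy_pos[OF that \<open>\<sigma> > 0\<close>] by simp
  with I show ?thesis by auto
qed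

end
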